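(* Let $m,n\ge 1$ be integers and let $a>1$ be a fixed real number. For each $0\le j\le n$, the absolute value of the coefficient of $t^j$ in $\chi_{\mathcal{A}_n^{(m)}}(t)$ is the number of decorated $m$-Dyck paths of size $n$ for which the second labeled Dyck path has $j$ compartments.
   Context: $\mathcal{A}_n^{(m)}$ denotes the hyperplane arrangement in $\mathbb{R}^n$ given by $\{x_i=0 \mid i\in[n]\}\cup\{x_i=a^kx_j \mid k\in[-m,m],\ 1\le i<j\le n\}$, where $[n]=\{1,\dots,n\}$ and $[-m,m]$ is the set of integers from $-m$ to $m$. The intersection poset $\mathrm{L}(\mathcal{A})$ of an arrangement $\mathcal{A}$ in $\mathbb{R}^n$ is the set of flats (nonempty intersections of some of the hyperplanes, including the empty intersection $\mathbb{R}^n$), ordered by reverse inclusion, with minimum $\hat 0=\mathbb{R}^n$. The characteristic polynomial is $\chi_{\mathcal{A}}(t)=\sum_{x\in \mathrm{L}(\mathcal{A})}\mu(\hat 0,x)\,t^{\dim x}$, where $\mu$ is the Möbius function of $\mathrm{L}(\mathcal{A})$. A labeled $m$-Dyck path with $k$ up-steps ($k\ge 0$) and label set $L$, where $L$ is a set of $k$ positive integers, is a sequence of $(m+1)k$ terms of which $k$ are $+m$ (up-steps) and $mk$ are $-1$ (down-steps), such that the sum of any prefix is non-negative and the $+m$ terms are labeled bijectively by $L$. It is drawn in $\mathbb{R}^2$ from $(0,0)$ with steps $(1,m)$ for up-steps and $(1,-1)$ for down-steps. A labeled $m$-Dyck path of size $n$ is one with label set $[n]$. A decorated $m$-Dyck path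 of size $n$ is a labeled $m$-Dyck path of size $n$ together with a choice of a point on the path lying on the $x$-axis. Equivalently, cutting at the chosen point, it is an ordered pair of (possibly empty) labeled $m$-Dyck paths with disjoint label sets whose union is $[n]$. The second labeled Dyck path is the part after the chosen point. Compartments: a labeled $m$-Dyck path breaks up into consecutive primitive parts according to when it touches the $x$-axis (each primitive part touches the $x$-axis only at its two endpoints). If the largest label of the path is in the $i_1$-th primitive part, then the primitive parts up to and including the $i_1$-th form the first compartment. If the largest label not occurring in the first compartment is in the $i_2$-th primitive part, then the primitive parts after the $i_1$-th up to and including the $i_2$-th form the second compartment. One continues in this way until all primitive parts are used. The empty path has $0$ compartments. *)

theory Defs
  imports "HOL-Analysis.Analysis" "HOL-Computational_Algebra.Polynomial"
begin

subsection \<open>Arrangements and characteristic polynomials\<close>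

text \<open>
  Coordinates are indexed by a finite linearly ordered type, which is order-isomorphic
  to \<open>{1..n}\<close> for \<open>n = CARD('n)\<close>.
\<close>

definition arrangement :: "real \<Rightarrow> nat \<Rightarrow> (real ^ 'n::{finite,linorder}) set set" where
  "arrangement a m =
     {{x. x $ i = 0} | i. True} \<union>
     {{x. x $ i = a powi k * x $ j} | i j k. i < j \<and> k \<in> {- int m..int m}}"

definition flats :: "'a set set \<Rightarrow> 'a set set" where
  "flats A = {\<Inter>B | B. B \<subseteq> A \<and> \<Inter>B \<noteq> {}}"

definition reverse_inclusion :: "'a set set \<Rightarrow> ('a set \<times> 'a set) set" where
  "reverse_inclusion P = {(x, y). x \<in> P \<and> y \<in> P \<and> y \<subseteq> x}"

text \<open>The value is 0 if \<open>x\<close> is not below \<open>y\<close>, and on anything that is not a finite poset.\<close>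

function mobius :: "'a set \<Rightarrow> ('a \<times> 'a) set \<Rightarrow> 'a \<Rightarrow> 'a \<Rightarrow> int" where
  "mobius P r x y =
     (if finite P \<and> partial_order_on P r \<and> (x, y) \<in> r
      then if x = y then 1
           else - (\<Sum>z\<in>{z \<in> P. (x, z) \<in> r \<and> (z, y) \<in> r \<and> z \<noteq> y}. mobius P r x z)
      else 0)"
  by pat_completeness auto
termination
proof (relation "inv_image less_than (\<lambda>(P, r, x, y). card {z \<in> P. (z, y) \<in> r})")
  fix P :: "'a set" and r :: "('a \<times> 'a) set" and x y z
  assume *: "finite P \<and> partial_order_on P r \<and> (x, y) \<in> r"
    and z: "z \<in> {z \<in> P. (x, z) \<in> r \<and> (z, y) \<in> r \<and> z \<noteq> y}"
  have po: "trans r" "antisym r" "refl_on P r" "r \<subseteq> P \<times> P"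
    using * by (auto simp: partial_order_on_def preorder_on_def)
  have "{w \<in> P. (w, z) \<in> r} \<subseteq> {w \<in> P. (w, y) \<in> r}"
    using po(1) z by (auto dest: transD)
  moreover have "y \<in> {w \<in> P. (w, y) \<in> r}" "y \<notin> {w \<in> P. (w, z) \<in> r}"
    using * z po by (auto dest: antisymD refl_onD)
  ultimately have "{w \<in> P. (w, z) \<in> r} \<subset> {w \<in> P. (w, y) \<in> r}"
    by blast
  then show "((P, r, x, z), (P, r, x, y)) \<in> inv_image less_than (\<lambda>(P, r, x, y). card {z \<in> P. (z, y) \<in> r})"
    using * by (auto intro: psubset_card_mono)
qed (simp add: wf_inv_image)

declare mobius.simps [simp del]

text \<open>
  Flats are affine subspaces, so their dimension is \<^const>\<open>aff_dim\<close>, which is non-negative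
  because flats are nonempty.
\<close>

definition characteristic_poly :: "'a::euclidean_space set set \<Rightarrow> int poly" where
  "characteristic_poly A =
     (\<Sum>x\<in>flats A. monom (mobius (flats A) (reverse_inclusion (flats A)) UNIV x) (nat (aff_dim x)))"

lemma partial_order_on_reverse_inclusion: "partial_order_on P (reverse_inclusion P)"
  by (auto simp: partial_order_on_def preorder_on_def reverse_inclusion_def
      refl_on_def trans_def antisym_def)

lemma finite_flats: "finite A \<Longrightarrow> finite (flats A)"
  by (rule finite_subset[of _ "Inter ` Pow A"]) (auto simp: flats_def)

lemma finite_arrangement: "finite (arrangement a m :: (real ^ 'n::{finite,linorder}) set set)"
proof -
  have "arrangement a m \<subseteq>
      range (\<lambda>i. {x :: real ^ 'n::{finite,linorder}. x $ i = 0}) \<union>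
      (\<lambda>(i, j, k). {x :: real ^ 'n::{finite,linorder}. x $ i = a powi k * x $ j}) ` (UNIV \<times> UNIV \<times> {- int m..int m})"
    by (force simp: arrangement_def)
  then show ?thesis
    by (rule finite_subset) auto
qed


subsection \<open>Decorated Dyck paths\<close>

datatype step = Up nat | Down

fun step_height :: "nat \<Rightarrow> step \<Rightarrow> int" where
  "step_height m (Up l) = int m"
| "step_height m Down = -1"

definition height :: "nat \<Rightarrow> step list \<Rightarrow> int" where
  "height m w = sum_list (map (step_height m) w)"

fun labels :: "step list \<Rightarrow> nat list" where
  "labels [] = []"
| "labels (Up l # w) = l # labels w"
| "labels (Down # w) = labels w"

definition labeled_dyck_path :: "nat \<Rightarrow> nat set \<Rightarrow> step list \<Rightarrow> bool" where
  "labeled_dyck_path m L w \<longleftrightarrow>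
     finite L \<and> 0 \<notin> L \<and>
     length w = (m + 1) * card L \<and>
     distinct (labels w) \<and> set (labels w) = L \<and>
     (\<forall>i\<le>length w. height m (take i w) \<ge> 0)"

text \<open>
  The chosen point is given by the number \<open>i\<close> of steps before it; a path meets the
  x-axis only at endpoints of steps. The second path is \<^term>\<open>drop i w\<close>.
\<close>

definition decorated_dyck_paths :: "nat \<Rightarrow> nat \<Rightarrow> (step list \<times> nat) set" where
  "decorated_dyck_paths m n =
     {(w, i). labeled_dyck_path m {1..n} w \<and> i \<le> length w \<and> height m (take i w) = 0}"

text \<open>
  A nonempty Dyck path always returns to height 0, so for Dyck paths the first
  conditional fails only for the empty path.
\<close>

function primitive_parts :: "nat \<Rightarrow> step list \<Rightarrow> step list list" where
  "primitive_parts m w =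
     (if \<exists>i. 0 < i \<and> i \<le> length w \<and> height m (take i w) = 0
      then let i = (LEAST i. 0 < i \<and> i \<le> length w \<and> height m (take i w) = 0)
           in take i w # primitive_parts m (drop i w)
      else [])"
  by pat_completeness auto
termination
proof (relation "inv_image less_than (\<lambda>(m, w). length w)")
  fix m :: nat and w :: "step list" and i
  assume ex: "\<exists>i. 0 < i \<and> i \<le> length w \<and> height m (take i w) = 0"
    and i: "i = (LEAST i. 0 < i \<and> i \<le> length w \<and> height m (take i w) = 0)"
  have "0 < i \<and> i \<le> length w \<and> height m (take i w) = 0"
    unfolding i using ex by (rule LeastI_ex)
  then show "((m, drop i w), (m, w)) \<in> inv_image less_than (\<lambda>(m, w). length w)"
    by auto
qed (simp add: wf_inv_image)

declare primitive_parts.simps [simp del]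

text \<open>
  The argument is a sequence of primitive parts. As labels are distinct, the largest label
  outside the compartments already formed is the largest label of the remaining parts.
\<close>

function compartments :: "step list list \<Rightarrow> step list list list" where
  "compartments ps =
     (if ps = [] then []
      else let M = Max (set (labels (concat ps)));
               i = (LEAST i. i < length ps \<and> M \<in> set (labels (ps ! i)))
           in take (Suc i) ps # compartments (drop (Suc i) ps))"
  by pat_completeness auto
termination
  by (relation "inv_image less_than length") auto

declare compartments.simps [simp del]

definition num_compartments :: "nat \<Rightarrow> step list \<Rightarrow> nat" where
  "num_compartments m w = length (compartments (primitive_parts m w))"

lemma set_labels: "l \<in> set (labels w) \<longleftrightarrow> Up l \<in> set w"
  by (induction w rule: labels.induct) auto

lemma finite_decorated_dyck_paths: "finite (decorated_dyck_paths m n)"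
proof (rule finite_subset)
  let ?S = "insert Down (Up ` {1..n})"
  have "x \<in> ?S" if "set (labels w) = {1..n}" "x \<in> set w" for x w
    using that set_labels[of _ w] by (cases x) auto
  then show "decorated_dyck_paths m n \<subseteq>
      {w. set w \<subseteq> ?S \<and> length w = (m + 1) * n} \<times> {..(m + 1) * n}"
    by (auto simp: decorated_dyck_paths_def labeled_dyck_path_def)
  show "finite ({w. set w \<subseteq> ?S \<and> length w = (m + 1) * n} \<times> {..(m + 1) * n})"
    using finite_lists_length_eq[of ?S] by (intro finite_cartesian_product) auto
qed

end

theory Submission
  imports Defs "HOL-Library.Real_Mod"
begin

text \<open>
  Both sides are computed, and the common answer is
  \<open>(t + 1) (t + m n + 2) (t + m n + 3) \<cdots> (t + m n + n)\<close>: this is the generating polynomial of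
  the decorated paths by number of compartments, and \<open>(-1)\<^sup>n\<close> times its value at
  \<open>-t\<close> is the characteristic polynomial. Write
  \<open>f\<^sub>n(r) = r \<Prod>\<^sub>i (r + m n + i)\<close> with \<open>i\<close> from \<open>1\<close> to
  \<open>n - 1\<close> (\<open>rothe\<close>), so that the polynomial is \<open>f\<^sub>n(t + 1)\<close>. These
  are the polynomials with exponential generating function \<open>F\<^sup>r\<close>, where
  \<open>F = 1 + x F\<^sup>m\<^sup>+\<^sup>1\<close> enumerates labeled Dyck paths.

  Paths. Removing the first step of a walk that starts at height \<open>h\<close> gives a walk from height
  \<open>h - 1\<close> with the same labels or one from height \<open>h + m\<close> with one label fewer, so a sum
  over walks whose weights ignore the first step obeys
  \<open>W\<^sub>n(h) = W\<^sub>n(h - 1) + n W\<^sub>n\<^sub>-\<^sub>1(h + m)\<close>. The polynomials satisfy the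
  same recursion \<open>f\<^sub>n(r + 1) = f\<^sub>n(r) + n f\<^sub>n\<^sub>-\<^sub>1(r + 1 + m)\<close>
  (\<open>rothe_rec\<close>). The first compartment ends at the first return to the axis after the largest label
  (\<open>num_compartments_walk\<close>). Hence the sum over walks of \<open>t\<close> to the number of
  compartments after the first return and the sum in which the largest label has to be met before that return form
  a closed system of recursions, whose solution is explicit (\<open>sum_after_closed_forms\<close>). Paths
  weighted by \<open>t\<close> to the number of all their compartments thus have total weight
  \<open>f\<^sub>n(t)\<close>, and adding the choice of a point shifts the argument by one
  (\<open>decorated_enumerator\<close>).

  Arrangement. The equations \<open>x\<^sub>i = 0\<close> and \<open>x\<^sub>i = b\<^sup>k x\<^sub>j\<close> make
  sense over every field. Gaussian elimination for such equations only moves powers of \<open>b\<close> around,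
  and it only needs to know which powers of \<open>b\<close> equal one. It therefore runs identically for the real
  number \<open>b = a\<close> and for a root of unity \<open>b\<close> of large order \<open>N\<close>, and a flat
  of dimension \<open>d\<close> has \<open>(N + 1)\<^sup>d\<close> solutions with coordinates in the set
  consisting of zero and the \<open>N\<close>-th roots of unity (\<open>card_model_flat\<close>). As in the finite
  field method, Moebius inversion then shows that \<open>\<chi>(N + 1)\<close> is the number of such points on no
  hyperplane (\<open>characteristic_poly_finite_model\<close>). These points are the placements of
  \<open>n\<close> labels on a cycle of length \<open>N\<close> with all distances larger than \<open>m\<close>,
  and there are \<open>N (N - m n - 1) \<cdots> (N - m n - n + 1) = (-1)\<^sup>n f\<^sub>n(-N)\<close> of them
  (\<open>card_cyclic_spaced_rothe\<close>). Equality for all large \<open>N\<close> determines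
  \<open>\<chi>\<close>.
\<close>

section \<open>Walks down to the axis and their first steps\<close>

text \<open>
  Labeled walks from height \<open>h\<close> that stay non-negative and use each label of \<open>L\<close> once,
  described by their first step. Ending at height \<open>0\<close> replaces the length condition of a labeled Dyck
  path, and starting heights other than \<open>0\<close> are what makes the recursion close.
\<close>

fun walk :: "nat \<Rightarrow> nat \<Rightarrow> nat set \<Rightarrow> step list \<Rightarrow> bool" where
  "walk m h L [] \<longleftrightarrow> h = 0 \<and> L = {}"
| "walk m h L (Down # w) \<longleftrightarrow> h > 0 \<and> walk m (h - 1) L w"
| "walk m h L (Up l # w) \<longleftrightarrow> l \<in> L \<and> walk m (h + m) (L - {l}) w"

lemma height_simps [simp]:
  "height m [] = 0" "height m (s # w) = step_height m s + height m w"
  by (simp_all add: height_def)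

lemma height_append [simp]: "height m (u @ v) = height m u + height m v"
  by (simp add: height_def)

lemma all_le_Suc_iff: "(\<forall>i\<le>Suc n. P i) \<longleftrightarrow> P 0 \<and> (\<forall>i\<le>n. P (Suc i))"
  by (metis Suc_le_mono not0_implies_Suc zero_le)

text \<open>
  The length condition forces the final height \<open>0\<close>: there are \<open>card L\<close> up-steps, which
  leaves \<open>h + m * card L\<close> down-steps.
\<close>

lemma walk_iff:
  assumes "finite L"
  shows "walk m h L w \<longleftrightarrow> length w = h + (m + 1) * card L \<and> distinct (labels w) \<and> set (labels w) = L \<and>
           (\<forall>i\<le>length w. int h + height m (take i w) \<ge> 0)"
  using assms
proof (induction m h L w rule: walk.induct)
  case (1 m h L)
  then show ?case by auto
next
  case (2 m h L w)
  show ?case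
  proof (cases h)
    case 0
    then show ?thesis by (auto intro!: exI[of _ 1])
  next
    case (Suc h')
    with 2 show ?thesis by (simp add: all_le_Suc_iff algebra_simps)
  qed
next
  case (3 m h L l w)
  show ?case
  proof (cases "l \<in> L")
    case True
    have c: "card L = Suc (card (L - {l}))"
      using 3(2) True by (intro card.remove)
    have len: "length w = h + m + (m + 1) * card (L - {l}) \<longleftrightarrow> length (Up l # w) = h + (m + 1) * card L"
      unfolding c by (simp add: algebra_simps)
    have lab: "distinct (labels w) \<and> set (labels w) = L - {l} \<longleftrightarrow>
        distinct (labels (Up l # w)) \<and> set (labels (Up l # w)) = L"
      using True by auto
    have pre: "(\<forall>i\<le>length w. int (h + m) + height m (take i w) \<ge> 0) \<longleftrightarrow>
        (\<forall>i\<le>length (Up l # w). int h + height m (take i (Up l # w)) \<ge> 0)"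
      by (simp add: all_le_Suc_iff add.assoc)
    have "walk m h L (Up l # w) \<longleftrightarrow> walk m (h + m) (L - {l}) w"
      using True by simp
    also have "\<dots> \<longleftrightarrow> length w = h + m + (m + 1) * card (L - {l}) \<and> (distinct (labels w) \<and>
        set (labels w) = L - {l}) \<and> (\<forall>i\<le>length w. int (h + m) + height m (take i w) \<ge> 0)"
      using 3 True by simp
    finally show ?thesis
      unfolding len lab pre by simp
  qed auto
qed

lemma labeled_dyck_path_iff:
  assumes "finite L" "0 \<notin> L"
  shows "labeled_dyck_path m L w \<longleftrightarrow> walk m 0 L w"
  using assms by (simp add: labeled_dyck_path_def walk_iff)

lemma walk_appendD:
  assumes "walk m h L (u @ v)"
  shows "int h + height m u \<ge> 0 \<and> walk m (nat (int h + height m u)) (L - set (labels u)) v"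
  using assms
proof (induction m h L u rule: walk.induct)
  case (2 m h L w)
  then have "int (h - 1) + height m w = int h + height m (Down # w)"
    using 2(2) by (simp add: of_nat_diff)
  with 2 show ?case by (metis append_Cons labels.simps(3) walk.simps(2))
next
  case (3 m h L l w)
  have "int (h + m) + height m w = int h + height m (Up l # w)"
    by simp
  moreover have "L - {l} - set (labels w) = L - set (labels (Up l # w))"
    by auto
  moreover have "walk m (h + m) (L - {l}) (w @ v)"
    using 3(2) by simp
  ultimately show ?case
    using 3(1) by metis
qed auto

definition walks where "walks m h L = {w. walk m h L w}"

lemma walks_unfold:
  "walks m h L = (if h = 0 \<and> L = {} then {[]} else {}) \<union>
     (if h > 0 then Cons Down ` walks m (h - 1) L else {}) \<union>
     (\<Union>l\<in>L. Cons (Up l) ` walks m (h + m) (L - {l}))"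
  (is "_ = ?R")
proof (rule set_eqI)
  fix w show "w \<in> walks m h L \<longleftrightarrow> w \<in> ?R"
  proof (cases w)
    case (Cons s v)
    then show ?thesis by (cases s) (auto simp: walks_def)
  qed (auto simp: walks_def)
qed

text \<open>
  Induction along \<open>sum_walks\<close>: an up-step raises the height but uses up a label, so walks are ordered
  by the number of labels first and by the height second.
\<close>

lemma first_step_induct [consumes 1, case_names step]:
  fixes P :: "nat \<Rightarrow> 'a set \<Rightarrow> bool"
  assumes "finite L"
    and "\<And>h L. finite L \<Longrightarrow> (\<And>l. l \<in> L \<Longrightarrow> P (h + m) (L - {l})) \<Longrightarrow> (h > 0 \<Longrightarrow> P (h - 1) L) \<Longrightarrow> P h L"
  shows "P h L"
  using assms(1)
proof (induction "card L" arbitrary: h L)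
  case 0
  then have L: "L = {}" by simp
  show ?case unfolding L by (induction h) (rule assms(2), auto)+
next
  case (Suc n)
  have up: "P h (L - {l})" if "l \<in> L" for h l
    using that Suc(2,3) by (intro Suc(1)) auto
  show ?case
  proof (induction h)
    case 0
    show ?case by (rule assms(2)) (use up Suc(3) in auto)
  next
    case (Suc h)
    show ?case by (rule assms(2)) (use up \<open>finite L\<close> Suc in auto)
  qed
qed

lemma finite_walks: "finite L \<Longrightarrow> finite (walks m h L)"
proof (induction h L rule: first_step_induct[where m = m])
  case (step h L)
  then have "finite (\<Union>l\<in>L. Cons (Up l) ` walks m (h + m) (L - {l}))"
    by blast
  moreover have "finite (if h > 0 then Cons Down ` walks m (h - 1) L else {})"
    using step(3) by (cases "h > 0") auto
  ultimately show ?case by (simp only: walks_unfold[of m h L] finite_Un if_split finite.intros simp_thms)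
qed

lemma sum_walks:
  fixes \<phi> :: "step list \<Rightarrow> 'b::comm_monoid_add"
  assumes "finite L"
  shows "(\<Sum>w\<in>walks m h L. \<phi> w) = (if h = 0 \<and> L = {} then \<phi> [] else 0) +
     (if h > 0 then \<Sum>w\<in>walks m (h - 1) L. \<phi> (Down # w) else 0) +
     (\<Sum>l\<in>L. \<Sum>w\<in>walks m (h + m) (L - {l}). \<phi> (Up l # w))"
proof -
  have fin: "finite (walks m h L')" if "L' \<subseteq> L" for h L'
    using that assms finite_subset finite_walks by blast
  show ?thesis
    apply (subst walks_unfold)
    apply (subst sum.union_disjoint)
       apply (auto simp: assms fin)[3]
    apply (subst sum.union_disjoint)
       apply (auto simp: assms fin)[3]
    apply (subst sum.UNION_disjoint)
       apply (auto simp: assms fin)[3]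
    apply (simp add: sum.reindex)
    done
qed

section \<open>Compartments read from left to right\<close>

text \<open>
  What is left of a walk once it has reached height \<open>0\<close>. A walk that starts there has already
  arrived.
\<close>

fun after_return :: "nat \<Rightarrow> nat \<Rightarrow> step list \<Rightarrow> step list" where
  "after_return m 0 w = w"
| "after_return m (Suc h) [] = []"
| "after_return m (Suc h) (Down # w) = after_return m h w"
| "after_return m (Suc h) (Up l # w) = after_return m (Suc h + m) w"

text \<open>
  What is left of a walk once it has met the label \<open>M\<close> and afterwards reached height
  \<open>0\<close>. For a Dyck path with largest label \<open>M\<close> this removes exactly the first
  compartment, in a form that can be followed step by step.
\<close>

fun after_label :: "nat \<Rightarrow> nat \<Rightarrow> nat \<Rightarrow> step list \<Rightarrow> step list" where
  "after_label m M h [] = []"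
| "after_label m M h (Down # w) = after_label m M (h - 1) w"
| "after_label m M h (Up l # w) =
     (if l = M then after_return m (h + m) w else after_label m M (h + m) w)"

lemma all_less_Suc_iff: "(\<forall>i<Suc n. P i) \<longleftrightarrow> P 0 \<and> (\<forall>i<n. P (Suc i))"
  by (metis Suc_less_eq not0_implies_Suc zero_less_Suc)

lemma after_return_append:
  assumes "walk m h L (u @ v)" "int h + height m u = 0"
    "\<forall>i<length u. int h + height m (take i u) \<noteq> 0"
  shows "after_return m h (u @ v) = v"
  using assms
proof (induction m h u arbitrary: L rule: after_return.induct)
  case (1 m w)
  then show ?case by (cases w) (auto dest: spec[of _ 0])
next
  case (3 m h w)
  from 3(2-) show ?case by (auto simp: all_less_Suc_iff intro!: 3(1))
next
  case (4 m h l w)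
  have "int (Suc h + m) + height m u = int (Suc h) + height m (Up l # u)" for u
    by simp
  with 4(3,4) have "int (Suc h + m) + height m w = 0"
    "\<forall>i<length w. int (Suc h + m) + height m (take i w) \<noteq> 0"
    by (auto simp: all_less_Suc_iff)
  with 4(1)[of "L - {l}"] 4(2) show ?case by simp
qed auto

lemma after_label_append:
  assumes "walk m h L (u @ v)" "M \<notin> set (labels u)"
  shows "after_label m M h (u @ v) = after_label m M (nat (int h + height m u)) v"
  using assms
proof (induction m M h u arbitrary: L rule: after_label.induct)
  case (2 m M h w)
  then have e: "int (h - 1) + height m w = int h + height m (Down # w)"
    by (simp add: of_nat_diff)
  show ?case unfolding e[symmetric] using 2 by auto
next
  case (3 m M h l w)
  then show ?case by (auto simp: algebra_simps)
qed auto

text \<open>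
  The hypotheses say that after its start \<open>u\<close> comes to height \<open>0\<close> only at its end, so
  the return that follows the label \<open>M\<close> is the end of \<open>u\<close>.
\<close>

lemma after_label_primitive:
  assumes "walk m h L (u @ v)" "M \<in> set (labels u)" "int h + height m u = 0"
    "\<forall>i. 0 < i \<longrightarrow> i < length u \<longrightarrow> int h + height m (take i u) \<noteq> 0"
  shows "after_label m M h (u @ v) = v"
  using assms
proof (induction m M h u arbitrary: L rule: after_label.induct)
  case (2 m M h w)
  have "int h - 1 + height m (take i w) \<noteq> 0" if "i < length w" for i
    using 2(5)[rule_format, of "Suc i"] that by (auto simp: algebra_simps)
  moreover have "int (h - 1) = int h - 1"
    using 2(2) by (simp add: of_nat_diff)
  ultimately show ?case using 2(1)[of L] 2(2-4) by simp
next
  case (3 m M h l w)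
  have *: "int (h + m) + height m (take i w) \<noteq> 0" if "i < length w" for i
    using 3(5)[rule_format, of "Suc i"] that by (auto simp: algebra_simps)
  show ?case
  proof (cases "l = M")
    case True
    have "after_return m (h + m) (w @ v) = v"
      using 3(2-4) * by (intro after_return_append[of _ _ "L - {l}"]) (auto simp: algebra_simps)
    with True show ?thesis by simp
  next
    case False
    have "after_label m M (h + m) (w @ v) = v"
      using 3(2-4) * False by (intro 3(1)) (auto simp: algebra_simps)
    with False show ?thesis by simp
  qed
qed auto

lemma primitive_parts_Nil: "primitive_parts m [] = []"
  by (subst primitive_parts.simps) simp

lemma walk_end: "walk m h L w \<Longrightarrow> int h + height m w = 0"
  using walk_appendD[of m h L w "[]"] by simp

lemma primitive_parts_Cons:
  assumes "walk m 0 L w" "w \<noteq> []"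
  obtains u v where "w = u @ v" "u \<noteq> []" "height m u = 0"
    "\<forall>i. 0 < i \<longrightarrow> i < length u \<longrightarrow> height m (take i u) \<noteq> 0"
    "primitive_parts m w = u # primitive_parts m v"
proof -
  let ?P = "\<lambda>i. 0 < i \<and> i \<le> length w \<and> height m (take i w) = 0"
  define i where "i = (LEAST i. ?P i)"
  have ex: "?P (length w)"
    using assms walk_end[of m 0 L w] by auto
  then have i: "?P i" unfolding i_def by (rule LeastI)
  have "height m (take k w) \<noteq> 0" if "0 < k" "k < i" for k
    using not_less_Least[of k ?P] that i unfolding i_def by auto
  then have "\<forall>k. 0 < k \<longrightarrow> k < length (take i w) \<longrightarrow> height m (take k (take i w)) \<noteq> 0"
    using i by (auto simp: min_def)
  moreover have "primitive_parts m w = take i w # primitive_parts m (drop i w)"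
    unfolding i_def Let_def by (subst primitive_parts.simps) (use ex in \<open>auto simp: Let_def\<close>)
  ultimately show ?thesis
    using i by (intro that[of "take i w" "drop i w"]) auto
qed

lemma labels_append [simp]: "labels (u @ v) = labels u @ labels v"
  by (induction u rule: labels.induct) auto

lemma concat_primitive_parts:
  assumes "walk m 0 L w"
  shows "concat (primitive_parts m w) = w"
  using assms
proof (induction "length w" arbitrary: L w rule: less_induct)
  case less
  show ?case
  proof (cases "w = []")
    case False
    then obtain u v where uv: "w = u @ v" "u \<noteq> []" "height m u = 0"
      "primitive_parts m w = u # primitive_parts m v"
      using less primitive_parts_Cons by metis
    have "walk m 0 (L - set (labels u)) v"
      using walk_appendD[of m 0 L u v] less(2) uv by simp
    with less(1)[of v] uv show ?thesis by simp
  qed (simp add: primitive_parts_Nil)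
qed

text \<open>
  Trades the index of the first hit for a function by recursion on the list, which fits induction over primitive
  parts.
\<close>

lemma drop_Suc_Least:
  assumes "x \<in> set xs" "P x"
  shows "drop (Suc (LEAST i. i < length xs \<and> P (xs ! i))) xs = tl (dropWhile (\<lambda>x. \<not> P x) xs)"
  using assms
proof (induction xs)
  case (Cons y ys)
  show ?case
  proof (cases "P y")
    case True
    have "(LEAST i. i < length (y # ys) \<and> P ((y # ys) ! i)) = 0"
      using True by (intro Least_equality) auto
    with True show ?thesis by simp
  next
    case False
    then have x: "x \<in> set ys" using Cons by auto
    then obtain k where "k < length ys" "P (ys ! k)"
      using Cons(3) by (metis in_set_conv_nth)
    then have "(LEAST i. i < length (y # ys) \<and> P ((y # ys) ! i)) =
        Suc (LEAST i. i < length ys \<and> P (ys ! i))"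
      using False by (subst Least_Suc[of _ "Suc k"]) auto
    with False Cons.IH[OF x Cons(3)] show ?thesis by simp
  qed
qed auto

lemma primitive_parts_after_label:
  assumes "walk m 0 L w" "M \<in> L"
  shows "tl (dropWhile (\<lambda>p. M \<notin> set (labels p)) (primitive_parts m w)) =
           primitive_parts m (after_label m M 0 w)"
  using assms
proof (induction "length w" arbitrary: L w rule: less_induct)
  case less
  have "w \<noteq> []" using less by auto
  then obtain u v where uv: "w = u @ v" "u \<noteq> []" "height m u = 0"
      "\<forall>i. 0 < i \<longrightarrow> i < length u \<longrightarrow> height m (take i u) \<noteq> 0"
      "primitive_parts m w = u # primitive_parts m v"
    using less primitive_parts_Cons by metis
  have v: "walk m 0 (L - set (labels u)) v"
    using walk_appendD[of m 0 L u v] less(2) uv by simp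
  show ?case
  proof (cases "M \<in> set (labels u)")
    case True
    then have "after_label m M 0 w = v"
      using after_label_primitive[of m 0 L u v M] less uv by simp
    with True uv show ?thesis by simp
  next
    case False
    then have "after_label m M 0 w = after_label m M 0 v"
      using after_label_append[of m 0 L u v M] less uv by simp
    with False uv less(1)[OF _ v] less(3) show ?thesis by simp
  qed
qed

lemma num_compartments_Nil: "num_compartments m [] = 0"
  by (simp add: num_compartments_def primitive_parts_Nil compartments.simps)

text \<open>
  The recursive description of the statistic: only the largest label and the first return after it matter, the
  primitive parts do not appear any more.
\<close>

lemma num_compartments_walk:
  assumes "walk m 0 L w" "finite L" "L \<noteq> {}"
  shows "num_compartments m w = Suc (num_compartments m (after_label m (Max L) 0 w))"
proof -
  let ?ps = "primitive_parts m w"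
  have c: "concat ?ps = w" using assms concat_primitive_parts by blast
  have L: "set (labels w) = L" using assms by (simp add: walk_iff)
  have M: "Max L \<in> L" using assms by simp
  have set_concat: "set (labels (concat ps)) = (\<Union>p\<in>set ps. set (labels p))" for ps
    by (induction ps) auto
  then obtain p where p: "p \<in> set ?ps" "Max L \<in> set (labels p)"
    using c L M by (metis UN_E)
  have "compartments ?ps = take (Suc (LEAST i. i < length ?ps \<and> Max L \<in> set (labels (?ps ! i)))) ?ps #
      compartments (tl (dropWhile (\<lambda>p. Max L \<notin> set (labels p)) ?ps))"
    using p(1) drop_Suc_Least[of p ?ps "\<lambda>p. Max L \<in> set (labels p)", OF p]
    by (subst compartments.simps) (auto simp: Let_def c L)
  with primitive_parts_after_label[OF assms(1) M] show ?thesis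
    by (simp add: num_compartments_def)
qed

section \<open>Weighted enumeration of decorated paths\<close>

text \<open>
  \<open>r (r + m n + 1) \<cdots> (r + m n + n - 1)\<close>, which is \<open>n!\<close> times the coefficient of
  \<open>x\<^sup>n\<close> in \<open>F\<^sup>r\<close> for \<open>F = 1 + x F\<^sup>m\<^sup>+\<^sup>1\<close>.
\<close>

definition rothe :: "nat \<Rightarrow> nat \<Rightarrow> 'a \<Rightarrow> 'a::comm_semiring_1" where
  "rothe m n r = (if n = 0 then 1 else r * pochhammer (r + of_nat (m * n + 1)) (n - 1))"

text \<open>
  Coefficientwise this is
  \<open>F\<^sup>r\<^sup>+\<^sup>1 = F\<^sup>r + x F\<^sup>r\<^sup>+\<^sup>1\<^sup>+\<^sup>m\<close>. Apart from
  linear factors, all three terms share the same Pochhammer symbol.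
\<close>

lemma rothe_rec:
  fixes r :: "'a::comm_ring_1"
  shows "rothe m (Suc n) (r + 1) = rothe m (Suc n) r + of_nat (Suc n) * rothe m n (r + 1 + of_nat m)"
proof (cases n)
  case (Suc k)
  define a where "a = r + of_nat (m * Suc n + 1) + 1"
  define P where "P = pochhammer a k"
  have "rothe m (Suc n) (r + 1) = (r + 1) * (P * (a + of_nat k))"
    using Suc by (simp add: rothe_def a_def P_def pochhammer_Suc add_ac)
  moreover have "rothe m (Suc n) r = r * ((a - 1) * P)"
    using pochhammer_rec[of "a - 1" k] Suc
    by (simp add: rothe_def a_def P_def add_ac)
  moreover have "rothe m n (r + 1 + of_nat m) = (r + 1 + of_nat m) * P"
    using Suc by (simp add: rothe_def a_def P_def add_ac)
  ultimately show ?thesis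
    using Suc by (simp add: a_def algebra_simps)
qed (simp add: rothe_def)

text \<open>
  The weight of the walks from height \<open>h\<close> whose largest label is yet to come. First passages cut the
  walk up to the return that follows this label into \<open>h + 1\<close> pieces, one per level, and what comes
  after the return contributes \<open>F\<^sup>t\<close>. Marking the largest label differentiates a factor
  \<open>F\<close>; summing over the piece that contains it leads to
  \<open>(h + 1) F\<^sup>h\<^sup>-\<^sup>1\<^sup>+\<^sup>t F'\<close>, that is, \<open>(h + 1) / (h + t)\<close>
  times the derivative of \<open>F\<^sup>h\<^sup>+\<^sup>t\<close>. The definition is its coefficient, in which
  the factor \<open>h + t\<close> has cancelled.
\<close>

definition rothe_unmarked :: "nat \<Rightarrow> nat \<Rightarrow> 'a \<Rightarrow> 'a \<Rightarrow> 'a::comm_semiring_1" where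
  "rothe_unmarked m n t h = (h + 1) * pochhammer (h + t + of_nat (m * n + 1)) (n - 1)"

text \<open>
  The last summand accounts for the step that carries the largest label; the other up-steps have \<open>n\<close>
  labels to choose from.
\<close>

lemma rothe_unmarked_rec:
  fixes t h :: "'a::comm_ring_1"
  shows "rothe_unmarked m (Suc n) t (h + 1) = rothe_unmarked m (Suc n) t h +
           of_nat n * rothe_unmarked m n t (h + 1 + of_nat m) + rothe m n (h + 1 + of_nat m + t)"
proof (cases n)
  case (Suc k)
  define a where "a = h + t + of_nat (m * Suc n + 1) + 1"
  define P where "P = pochhammer a k"
  have "rothe_unmarked m (Suc n) t (h + 1) = (h + 2) * (P * (a + of_nat k))"
    using Suc by (simp add: rothe_unmarked_def a_def P_def pochhammer_Suc add_ac)
  moreover have "rothe_unmarked m (Suc n) t h = (h + 1) * ((a - 1) * P)"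
    using pochhammer_rec[of "a - 1" k] Suc
    by (simp add: rothe_unmarked_def a_def P_def add_ac)
  moreover have "rothe_unmarked m n t (h + 1 + of_nat m) = (h + 2 + of_nat m) * P"
    using Suc by (simp add: rothe_unmarked_def a_def P_def add_ac)
  moreover have "rothe m n (h + 1 + of_nat m + t) = (h + 1 + of_nat m + t) * P"
    using Suc by (simp add: rothe_def a_def P_def add_ac)
  ultimately show ?thesis
    using Suc by (simp add: a_def algebra_simps)
qed (simp add: rothe_def rothe_unmarked_def)

lemma rothe_unmarked_0: "t * rothe_unmarked m (Suc n) t 0 = rothe m (Suc n) t"
  by (simp add: rothe_unmarked_def rothe_def algebra_simps)

text \<open>
  The recursion at height \<open>0\<close>, where no down-step is possible: the factor \<open>h + 1\<close>
  vanishes one level below.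
\<close>

lemma rothe_unmarked_start:
  fixes t :: "'a::comm_ring_1"
  shows "rothe_unmarked m (Suc n) t 0 = of_nat n * rothe_unmarked m n t (of_nat m) + rothe m n (of_nat m + t)"
  using rothe_unmarked_rec[of m n t "-1"] by (simp add: rothe_unmarked_def)

definition sum_after_return :: "nat \<Rightarrow> 'a \<Rightarrow> nat \<Rightarrow> nat set \<Rightarrow> 'a::comm_ring_1" where
  "sum_after_return m t h L = (\<Sum>w\<in>walks m h L. t ^ num_compartments m (after_return m h w))"

definition sum_after_max :: "nat \<Rightarrow> 'a \<Rightarrow> nat \<Rightarrow> nat set \<Rightarrow> 'a::comm_ring_1" where
  "sum_after_max m t h L = (\<Sum>w\<in>walks m h L. t ^ num_compartments m (after_label m (Max L) h w))"

lemma sum_after_return_step: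
  assumes "finite L" "h > 0"
  shows "sum_after_return m t h L = sum_after_return m t (h - 1) L +
           (\<Sum>l\<in>L. sum_after_return m t (h + m) (L - {l}))"
  using assms unfolding sum_after_return_def
  by (subst sum_walks[of L _ m h]; cases h; simp)

lemma sum_after_max_step:
  assumes "finite L" "L \<noteq> {}"
  shows "sum_after_max m t h L = (if h > 0 then sum_after_max m t (h - 1) L else 0) +
           (\<Sum>l\<in>L - {Max L}. sum_after_max m t (h + m) (L - {l})) +
           sum_after_return m t (h + m) (L - {Max L})"
proof -
  have "Max (L - {l}) = Max L" if "l \<in> L - {Max L}" for l
    using that assms by (intro Max_eqI) auto
  moreover have "Max L \<in> L" using assms by simp
  ultimately show ?thesis
    using assms unfolding sum_after_max_def sum_after_return_def
    by (subst sum_walks) (simp_all add: sum.remove[of L "Max L"] algebra_simps)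
qed

text \<open>
  At height \<open>0\<close> nothing has to be removed, so the whole path counts; splitting off its first
  compartment costs a factor \<open>t\<close>. This couples the two sums.
\<close>

lemma sum_after_return_0:
  assumes "finite L" "L \<noteq> {}"
  shows "sum_after_return m t 0 L = t * sum_after_max m t 0 L"
  using assms unfolding sum_after_max_def sum_after_return_def sum_distrib_left
  by (intro sum.cong refl) (auto simp: walks_def num_compartments_walk)

text \<open>
  The two recursions refer to each other. In the induction step the sum over walks with the largest label ahead
  has to come first, because the other sum at height \<open>0\<close> is expressed through it with the same
  labels.
\<close>

lemma sum_after_closed_forms:
  fixes t :: "'a::comm_ring_1"
  assumes "finite L"
  shows "sum_after_return m t h L = rothe m (card L) (of_nat h + t) \<and>
     (L \<noteq> {} \<longrightarrow> sum_after_max m t h L = rothe_unmarked m (card L) t (of_nat h))"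
  using assms
proof (induction h L rule: first_step_induct[where m = m])
  case (step h L)
  note fin = step(1)
  have card: "card (L - {l}) = card L - 1" if "l \<in> L" for l
    using that fin by simp
  have up: "sum_after_return m t (h + m) (L - {l}) = rothe m (card L - 1) (of_nat h + of_nat m + t)"
    "L - {l} \<noteq> {} \<Longrightarrow> sum_after_max m t (h + m) (L - {l}) = rothe_unmarked m (card L - 1) t (of_nat h + of_nat m)"
    if "l \<in> L" for l
    using step(2)[OF that] card[OF that] by simp_all
  have down: "sum_after_return m t (h - 1) L = rothe m (card L) (of_nat (h - 1) + t)"
    "L \<noteq> {} \<Longrightarrow> sum_after_max m t (h - 1) L = rothe_unmarked m (card L) t (of_nat (h - 1))" if "h > 0"
    using step(3)[OF that] by simp_all
  have Q: "sum_after_max m t h L = rothe_unmarked m (card L) t (of_nat h)" if ne: "L \<noteq> {}"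
  proof -
    have M: "Max L \<in> L" using that fin by simp
    obtain n where n: "card L = Suc n" using ne fin by (cases "card L") auto
    have "(\<Sum>l\<in>L - {Max L}. sum_after_max m t (h + m) (L - {l})) =
        (\<Sum>l\<in>L - {Max L}. rothe_unmarked m n t (of_nat h + of_nat m))"
      using M n by (intro sum.cong refl) (subst up, auto)
    also have "\<dots> = of_nat n * rothe_unmarked m n t (of_nat h + of_nat m)"
      using M n fin by simp
    finally show ?thesis
      using sum_after_max_step[OF fin that, of m t h] up(1)[OF M] down(2) that n
        rothe_unmarked_rec[of m n t "of_nat (h - 1)"] rothe_unmarked_start[of m n t]
      by (cases h) (simp_all add: algebra_simps)
  qed
  have R: "sum_after_return m t h L = rothe m (card L) (of_nat h + t)"
  proof (cases "h = 0")
    case True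
    show ?thesis
    proof (cases "L = {}")
      case True
      then show ?thesis using \<open>h = 0\<close>
        by (subst sum_after_return_def, subst sum_walks) (simp_all add: num_compartments_Nil rothe_def)
    next
      case False
      then obtain n where n: "card L = Suc n" using fin by (cases "card L") auto
      show ?thesis
        using sum_after_return_0[OF fin False, of m t] Q[OF False] True n rothe_unmarked_0[of t m n] by simp
    qed
  next
    case False
    then obtain h' where h': "h = Suc h'" by (cases h) auto
    have s: "(\<Sum>l\<in>L. sum_after_return m t (h + m) (L - {l})) =
        of_nat (card L) * rothe m (card L - 1) (of_nat h + of_nat m + t)"
      using up(1) by simp
    show ?thesis
    proof (cases "card L")
      case 0
      then show ?thesis using sum_after_return_step[OF fin, of h m t] h' down(1) s by (simp add: rothe_def)
    next
      case (Suc n)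
      then show ?thesis using sum_after_return_step[OF fin, of h m t] h' down(1) s rothe_rec[of m n "of_nat h' + t"]
        by (simp add: algebra_simps)
    qed
  qed
  show ?case using Q R by blast
qed

lemma compartment_enumerator:
  fixes t :: "'a::comm_ring_1"
  assumes "finite L"
  shows "(\<Sum>w\<in>walks m 0 L. t ^ num_compartments m w) = rothe m (card L) t"
  using sum_after_closed_forms[OF assms, of m t 0] by (simp add: sum_after_return_def)

fun sum_marked :: "nat \<Rightarrow> 'a \<Rightarrow> nat \<Rightarrow> step list \<Rightarrow> 'a::comm_ring_1" where
  "sum_marked m t h [] = (if h = 0 then 1 else 0)"
| "sum_marked m t h (Down # w) = (if h = 0 then t ^ num_compartments m (Down # w) else 0) + sum_marked m t (h - 1) w"
| "sum_marked m t h (Up l # w) = (if h = 0 then t ^ num_compartments m (Up l # w) else 0) + sum_marked m t (h + m) w"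

lemma zero_set_Cons:
  "{i. i \<le> length (s # w) \<and> int h + height m (take i (s # w)) = 0} =
   (if h = 0 then {0} else {}) \<union> Suc ` {i. i \<le> length w \<and> int h + step_height m s + height m (take i w) = 0}"
proof (rule set_eqI)
  fix i show "i \<in> {i. i \<le> length (s # w) \<and> int h + height m (take i (s # w)) = 0} \<longleftrightarrow> i \<in> 
   (if h = 0 then {0} else {}) \<union> Suc ` {i. i \<le> length w \<and> int h + step_height m s + height m (take i w) = 0}"
    by (cases i) (auto simp: algebra_simps)
qed

lemma sum_marked_eq:
  fixes t :: "'a::comm_ring_1"
  assumes "walk m h L w"
  shows "sum_marked m t h w =
    (\<Sum>i | i \<le> length w \<and> int h + height m (take i w) = 0. t ^ num_compartments m (drop i w))"
  using assms
proof (induction m h L w rule: walk.induct)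
  case (1 m h L)
  then show ?case by (simp add: num_compartments_Nil)
next
  case (2 m h L w)
  show ?case unfolding zero_set_Cons
    using 2 by (subst sum.union_disjoint) (auto simp: sum.reindex of_nat_diff algebra_simps)
next
  case (3 m h L l w)
  show ?case unfolding zero_set_Cons
    using 3 by (subst sum.union_disjoint) (auto simp: sum.reindex algebra_simps)
qed

text \<open>
  The recursion in \<open>h\<close> is the one of \<open>rothe\<close> at argument \<open>h + t + 1\<close>. At
  height \<open>0\<close> the missing down-step is made up for by marking the starting point, which contributes
  \<open>rothe m n t\<close>.
\<close>

lemma sum_sum_marked:
  fixes t :: "'a::comm_ring_1"
  assumes "finite L"
  shows "(\<Sum>w\<in>walks m h L. sum_marked m t h w) = rothe m (card L) (of_nat h + t + 1)"
  using assms
proof (induction h L rule: first_step_induct[where m = m])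
  case (step h L)
  note fin = step(1)
  let ?D = "\<lambda>h L. \<Sum>w\<in>walks m h L. sum_marked m t h w"
  have up: "(\<Sum>l\<in>L. ?D (h + m) (L - {l})) = of_nat (card L) * rothe m (card L - 1) (of_nat h + of_nat m + t + 1)"
    using fin step(2) by simp
  have down: "?D (h - 1) L = rothe m (card L) (of_nat (h - 1) + t + 1)" if "h > 0"
    using step(3)[OF that] .
  have rec: "rothe m (card L) (r + 1) = rothe m (card L) r + of_nat (card L) * rothe m (card L - 1) (r + 1 + of_nat m)" for r :: 'a
    by (cases "card L") (simp_all only: rothe_rec, simp_all add: rothe_def)
  show ?case
  proof (cases h)
    case 0
    have "?D 0 L = (\<Sum>w\<in>walks m 0 L. t ^ num_compartments m w) + (\<Sum>l\<in>L. ?D m (L - {l}))"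
      using fin by (simp add: sum_walks[of L _ m 0] sum.distrib num_compartments_Nil add.assoc)
    then show ?thesis
      using up rec[of t] 0 compartment_enumerator[OF fin, of t m] by (simp add: algebra_simps)
  next
    case (Suc h')
    have "?D h L = ?D h' L + (\<Sum>l\<in>L. ?D (h + m) (L - {l}))"
      unfolding Suc using fin by (subst sum_walks[of L _ m "Suc h'"]) simp_all
    then show ?thesis
      using up rec[of "of_nat h' + t + 1"] Suc down by (simp add: algebra_simps)
  qed
qed

theorem decorated_enumerator:
  fixes t :: "'a::comm_ring_1"
  shows "(\<Sum>(w, i)\<in>decorated_dyck_paths m n. t ^ num_compartments m (drop i w)) = rothe m n (t + 1)"
proof -
  have eq: "decorated_dyck_paths m n =
      (SIGMA w:walks m 0 {1..n}. {i. i \<le> length w \<and> int 0 + height m (take i w) = 0})"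
    by (auto simp: decorated_dyck_paths_def labeled_dyck_path_iff walks_def)
  have "(\<Sum>(w, i)\<in>decorated_dyck_paths m n. t ^ num_compartments m (drop i w)) =
      (\<Sum>w\<in>walks m 0 {1..n}.
         \<Sum>i | i \<le> length w \<and> int 0 + height m (take i w) = 0. t ^ num_compartments m (drop i w))"
    unfolding eq by (subst sum.Sigma[symmetric]) (simp_all add: finite_walks del: One_nat_def)
  also have "\<dots> = (\<Sum>w\<in>walks m 0 {1..n}. sum_marked m t 0 w)"
    by (intro sum.cong refl sum_marked_eq[symmetric]) (auto simp: walks_def)
  finally have "(\<Sum>(w, i)\<in>decorated_dyck_paths m n. t ^ num_compartments m (drop i w)) =
      (\<Sum>w\<in>walks m 0 {1..n}. sum_marked m t 0 w)" .
  then show ?thesis by (simp add: sum_sum_marked)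
qed

text \<open>
  Take \<open>t\<close> to be the polynomial variable.
\<close>

lemma decorated_coeff:
  "int (card {(w, i) \<in> decorated_dyck_paths m n. num_compartments m (drop i w) = j}) =
     coeff (rothe m n [:1, 1:]) j"
proof -
  have "rothe m n ([:1, 1:] :: int poly) =
      (\<Sum>(w, i)\<in>decorated_dyck_paths m n. monom 1 (num_compartments m (drop i w)))"
    using decorated_enumerator[where t = "[:0, 1:] :: int poly"]
    by (simp add: monom_altdef one_pCons)
  also have "coeff \<dots> j = (\<Sum>x\<in>decorated_dyck_paths m n. if (case x of (w, i) \<Rightarrow> num_compartments m (drop i w) = j) then 1 else 0)"
    unfolding coeff_sum by (intro sum.cong) auto
  also have "\<dots> = int (card {x \<in> decorated_dyck_paths m n. case x of (w, i) \<Rightarrow> num_compartments m (drop i w) = j})"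
    by (subst sum.inter_filter[symmetric]) (auto simp: finite_decorated_dyck_paths)
  also have "{x \<in> decorated_dyck_paths m n. case x of (w, i) \<Rightarrow> num_compartments m (drop i w) = j} =
      {(w, i) \<in> decorated_dyck_paths m n. num_compartments m (drop i w) = j}"
    by auto
  finally show ?thesis by simp
qed

section \<open>Spaced placements on a cycle\<close>

definition spaced :: "nat \<Rightarrow> 'a set \<Rightarrow> nat \<Rightarrow> ('a \<Rightarrow> nat) set" where
  "spaced m S l = {g \<in> S \<rightarrow>\<^sub>E {..<l}. \<forall>i\<in>S. \<forall>j\<in>S. i \<noteq> j \<longrightarrow> g i + m < g j \<or> g j + m < g i}"

lemma finite_spaced: "finite S \<Longrightarrow> finite (spaced m S l)"
  by (rule finite_subset[of _ "S \<rightarrow>\<^sub>E {..<l}"]) (auto simp: spaced_def intro: finite_PiE)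

lemma spaced_empty: "spaced m {} l = {\<lambda>x. undefined}"
  by (auto simp: spaced_def)

lemma spaced_0: "S \<noteq> {} \<Longrightarrow> spaced m S 0 = {}"
  by (auto simp: spaced_def PiE_def Pi_def)

text \<open>
  Either the last position is free, or it carries a label \<open>x\<close> and the \<open>m\<close> positions
  before it are free.
\<close>

lemma spaced_Suc:
  "spaced m S (Suc l) = spaced m S l \<union> (\<Union>x\<in>S. (\<lambda>g. g(x := l)) ` spaced m (S - {x}) (l - m))"
proof (intro equalityI subsetI)
  fix g assume g: "g \<in> spaced m S (Suc l)"
  show "g \<in> spaced m S l \<union> (\<Union>x\<in>S. (\<lambda>g. g(x := l)) ` spaced m (S - {x}) (l - m))"
  proof (cases "\<exists>x\<in>S. g x = l")
    case True
    then obtain x where x: "x \<in> S" "g x = l" by blast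
    have *: "g i < l - m" if "i \<in> S - {x}" for i
    proof -
      have "g i + m < g x \<or> g x + m < g i" "g i < Suc l"
        using g that x by (auto simp: spaced_def)
      then show ?thesis using x by linarith
    qed
    have "g(x := undefined) \<in> spaced m (S - {x}) (l - m)"
      using g * unfolding spaced_def by (auto simp: PiE_def extensional_def)
    moreover have "g = (g(x := undefined))(x := l)" using x by auto
    ultimately show ?thesis using x by blast
  next
    case False
    then have "g i < l" if "i \<in> S" for i
      using g that by (fastforce simp: spaced_def less_Suc_eq PiE_def Pi_def)
    then have "g \<in> spaced m S l"
      using g by (auto simp: spaced_def PiE_def Pi_def)
    then show ?thesis ..
  qed
next
  fix g assume "g \<in> spaced m S l \<union> (\<Union>x\<in>S. (\<lambda>g. g(x := l)) ` spaced m (S - {x}) (l - m))"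
  then consider "g \<in> spaced m S l" | x f where "x \<in> S" "f \<in> spaced m (S - {x}) (l - m)" "g = f(x := l)"
    by blast
  then show "g \<in> spaced m S (Suc l)"
  proof cases
    case 1
    then show ?thesis by (auto simp: spaced_def PiE_def Pi_def less_Suc_eq)
  next
    case 2
    have f: "f i < l - m" if "i \<in> S" "i \<noteq> x" for i
      using 2(2) that by (auto simp: spaced_def)
    have "f i = undefined" if "i \<notin> S" for i
      using 2(2) that by (auto simp: spaced_def PiE_def extensional_def)
    moreover have "f i + m < f j \<or> f j + m < f i" if "i \<in> S" "j \<in> S" "i \<noteq> j" "i \<noteq> x" "j \<noteq> x" for i j
      using 2(2) that by (auto simp: spaced_def)
    moreover have "f i < Suc l" "f i + m < l" if "i \<in> S" "i \<noteq> x" for i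
      using f[OF that] by linarith+
    ultimately show ?thesis using 2(1) unfolding 2(3)
      by (auto simp: spaced_def PiE_def Pi_def extensional_def)
  qed
qed

text \<open>
  With \<open>k\<close> labels, deleting \<open>m\<close> positions between consecutive labels leaves an arbitrary
  injection into \<open>l - m (k - 1)\<close> positions. Inductively this is Pascal's rule. The truncated
  subtraction is harmless: if it truncates, the binomial coefficient is zero, as is the number of placements.
\<close>

lemma card_spaced:
  assumes "finite S"
  shows "card (spaced m S l) = fact (card S) * ((l - m * (card S - 1)) choose card S)"
  using assms
proof (induction l arbitrary: S rule: less_induct)
  case (less l)
  note fin = less(2)
  show ?case
  proof (cases "S = {}")
    case True
    then show ?thesis by (simp add: spaced_empty)
  next
    case False
    then obtain k where k: "card S = Suc k" using fin by (cases "card S") auto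
    show ?thesis
    proof (cases l)
      case 0
      with False k show ?thesis by (simp add: spaced_0)
    next
      case (Suc l')
      \<comment> \<open>The placements with \<open>x\<close> on the last position.\<close>
      let ?U = "\<lambda>x. (\<lambda>g. g(x := l')) ` spaced m (S - {x}) (l' - m)"
      have val: "g x < l'" if "g \<in> spaced m S' (l' - d)" "x \<in> S'" for g x S' d
        using that by (fastforce simp: spaced_def PiE_def Pi_def)
      have inj: "inj_on (\<lambda>g. g(x := l')) (spaced m (S - {x}) (l' - m))" for x
      proof (rule inj_onI)
        fix f g assume "f \<in> spaced m (S - {x}) (l' - m)" "g \<in> spaced m (S - {x}) (l' - m)"
          and eq: "f(x := l') = g(x := l')"
        then have "f x = g x" by (auto simp: spaced_def PiE_def extensional_def)
        with eq show "f = g" by (metis fun_upd_triv fun_upd_upd)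
      qed
      have disj: "?U x \<inter> ?U y = {}" if "x \<in> S" "y \<in> S" "x \<noteq> y" for x y
      proof -
        have "f(x := l') \<noteq> g(y := l')" if "f \<in> spaced m (S - {x}) (l' - m)" for f g
          using val[OF that, of y] \<open>x \<noteq> y\<close> \<open>y \<in> S\<close> by (auto dest: fun_cong[of _ _ y])
        then show ?thesis by blast
      qed
      have disj': "spaced m S l' \<inter> (\<Union>x\<in>S. ?U x) = {}"
        using val[of _ S 0] by fastforce
      have cU: "card (?U x) = fact k * ((l' - m - m * (k - 1)) choose k)" if "x \<in> S" for x
        using that less(1)[of "l' - m" "S - {x}"] fin k Suc by (simp add: card_image inj)
      have "card (spaced m S l) = card (spaced m S l') + card (\<Union>x\<in>S. ?U x)"
        unfolding Suc spaced_Suc using disj' fin by (intro card_Un_disjoint) (auto simp: finite_spaced)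
      also have "card (\<Union>x\<in>S. ?U x) = (\<Sum>x\<in>S. card (?U x))"
        using fin disj by (intro card_UN_disjoint) (auto simp: finite_spaced)
      also have "\<dots> = fact (Suc k) * ((l' - m - m * (k - 1)) choose k)"
        using k by (simp add: cU algebra_simps)
      also have "card (spaced m S l') = fact (Suc k) * ((l' - m * k) choose Suc k)"
        using less(1)[of l' S] fin k Suc by simp
      finally have "card (spaced m S l) = fact (Suc k) *
          (((l' - m * k) choose Suc k) + ((l' - m - m * (k - 1)) choose k))"
        by (simp only: distrib_left)
      also have "((l' - m * k) choose Suc k) + ((l' - m - m * (k - 1)) choose k) = ((l - m * k) choose Suc k)"
      proof (cases k)
        case 0
        with Suc show ?thesis by simp
      next
        case (Suc k')
        then have "l' - m - m * (k - 1) = l' - m * k" by simp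
        moreover have "l - m * k = (if m * k \<le> l' then Suc (l' - m * k) else 0)"
          using \<open>l = Suc l'\<close> by auto
        ultimately show ?thesis using Suc by auto
      qed
      finally show ?thesis using k by simp
    qed
  qed
qed

definition cyclic_spaced :: "nat \<Rightarrow> nat \<Rightarrow> ('a \<Rightarrow> int) set" where
  "cyclic_spaced m N = {s \<in> UNIV \<rightarrow> {0..<int N}.
     \<forall>i j k. i \<noteq> j \<longrightarrow> \<bar>k\<bar> \<le> int m \<longrightarrow> \<not> int N dvd s i - s j - k}"

text \<open>
  A representative \<open>d\<close> less than \<open>N - m\<close> in size differs by less than \<open>N\<close>
  from every \<open>k\<close> with \<open>\<bar>k\<bar> \<le> m\<close>, so congruence to \<open>k\<close> is
  equality.
\<close>

lemma not_cong_small_iff: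
  fixes d :: int
  assumes "\<bar>d\<bar> < int N - int m"
  shows "(\<forall>k. \<bar>k\<bar> \<le> int m \<longrightarrow> \<not> int N dvd d - k) \<longleftrightarrow> \<bar>d\<bar> > int m"
proof
  assume "\<forall>k. \<bar>k\<bar> \<le> int m \<longrightarrow> \<not> int N dvd d - k"
  from spec[OF this, of d] show "\<bar>d\<bar> > int m" by auto
next
  assume d: "\<bar>d\<bar> > int m"
  show "\<forall>k. \<bar>k\<bar> \<le> int m \<longrightarrow> \<not> int N dvd d - k"
  proof (intro allI impI notI)
    fix k assume k: "\<bar>k\<bar> \<le> int m" "int N dvd d - k"
    have "d - k \<noteq> 0" "\<bar>d - k\<bar> < int N" using k(1) d assms by auto
    with k(2) show False by (metis dvd_imp_le_int abs_of_nat not_less)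
  qed
qed

text \<open>
  Cut the cycle at the position of one label, for which there are \<open>N\<close> choices. The \<open>m\<close>
  positions on either side of the cut are blocked, and the remaining \<open>N - 1 - 2 m\<close> positions form a
  line.
\<close>

lemma card_cyclic_spaced:
  assumes "N > 2 * m" "CARD('a::finite) = Suc k"
  shows "card (cyclic_spaced m N :: ('a \<Rightarrow> int) set) = N * (fact k * ((N - 1 - 2 * m - m * (k - 1)) choose k))"
proof -
  obtain o' :: 'a where True by blast
  let ?S = "UNIV - {o'}"
  let ?L = "N - 1 - 2 * m"
  let ?p = "\<lambda>g i. int (g i) + int m + 1"
  \<comment> \<open>\<open>b\<close> is the position of the label at the cut, and \<open>g\<close> counts positions from the first one that is not blocked.\<close>
  define F where "F = (\<lambda>(b, g) i. if i = o' then b else (b + ?p g i) mod int N)"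
  define G where "G = (\<lambda>s. (s o', \<lambda>i\<in>?S. nat ((s i - s o') mod int N - int m - 1)))"
  have N: "N > 0" using assms by simp
  have "bij_betw F ({0..<int N} \<times> spaced m ?S ?L) (cyclic_spaced m N)"
  proof (rule bij_betwI[where g = G])
    show "F \<in> {0..<int N} \<times> spaced m ?S ?L \<rightarrow> cyclic_spaced m N"
    proof (rule, clarify)
      fix b g assume b: "b \<in> {0..<int N}" and g: "g \<in> spaced m ?S ?L"
      let ?q = "\<lambda>i. if i = o' then 0 else ?p g i"
      have F: "F (b, g) i = (b + ?q i) mod int N" for i
        using b by (simp add: F_def)
      have mod_shift: "((b + x) mod int N - (b + y) mod int N - k) mod int N = (x - y - k) mod int N"
        for x y k
      proof -
        have "((b + x) mod int N - (b + y) mod int N - k) mod int N = (b + x - (b + y) - k) mod int N"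
          by (intro mod_diff_cong mod_diff_eq refl)
        then show ?thesis by simp
      qed
      have gb: "int (g i) < int N - 1 - 2 * int m" if "i \<noteq> o'" for i
      proof -
        have "g i < ?L" using g that by (auto simp: spaced_def)
        then show ?thesis by linarith
      qed
      have "\<not> int N dvd F (b, g) i - F (b, g) j - k" if ij: "i \<noteq> j" and k: "\<bar>k\<bar> \<le> int m" for i j k
      proof -
        have "\<bar>?q i - ?q j\<bar> < int N - int m \<and> \<bar>?q i - ?q j\<bar> > int m"
        proof (cases "i = o' \<or> j = o'")
          case True
          then show ?thesis using gb[of i] gb[of j] ij by auto
        next
          case False
          then have "g i + m < g j \<or> g j + m < g i"
            using g ij by (auto simp: spaced_def)
          then show ?thesis using gb[of i] gb[of j] False by auto
        qed
        then have "\<not> int N dvd (?q i - ?q j) - k"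
          using not_cong_small_iff[of "?q i - ?q j" N m] k by blast
        moreover have "(F (b, g) i - F (b, g) j - k) mod int N = ((?q i - ?q j) - k) mod int N"
          unfolding F mod_shift ..
        ultimately show ?thesis unfolding dvd_eq_mod_eq_0 by metis
      qed
      moreover have "F (b, g) i \<in> {0..<int N}" for i
        using N by (simp add: F)
      ultimately show "F (b, g) \<in> cyclic_spaced m N"
        by (auto simp: cyclic_spaced_def)
    qed
  next
    have key: "let q = (\<lambda>i. (s i - s o') mod int N) in
        (\<forall>i. i \<noteq> o' \<longrightarrow> int m < q i \<and> q i < int N - int m) \<and>
        (\<forall>i j. i \<noteq> j \<longrightarrow> i \<noteq> o' \<longrightarrow> j \<noteq> o' \<longrightarrow> \<bar>q i - q j\<bar> > int m)"
      if s: "s \<in> cyclic_spaced m N" for s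
    proof -
      define q where "q = (\<lambda>i. (s i - s o') mod int N)"
      have q: "0 \<le> q i" "q i < int N" for i using N by (auto simp: q_def)
      have q0: "q o' = 0" by (simp add: q_def)
      have nd: "\<not> int N dvd (q i - q j) - k" if "i \<noteq> j" "\<bar>k\<bar> \<le> int m" for i j k
      proof -
        have "((q i - q j) - k) mod int N = (s i - s o' - (s j - s o') - k) mod int N"
          unfolding q_def by (intro mod_diff_cong mod_diff_eq refl)
        then have "((q i - q j) - k) mod int N = (s i - s j - k) mod int N"
          by simp
        moreover have "\<not> int N dvd s i - s j - k" using s that by (auto simp: cyclic_spaced_def)
        ultimately show ?thesis unfolding dvd_eq_mod_eq_0 by metis
      qed
      have A: "int m < q i \<and> q i < int N - int m" if "i \<noteq> o'" for i
      proof -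
        have "\<not> int N dvd q i - k" if "\<bar>k\<bar> \<le> int m" for k
          using nd[of i o' k] q0 \<open>i \<noteq> o'\<close> that by simp
        from this[of "q i"] this[of "q i - int N"]
        have "\<not> \<bar>q i\<bar> \<le> int m" "\<not> \<bar>q i - int N\<bar> \<le> int m" by auto
        then show ?thesis using q[of i] by linarith
      qed
      have B: "\<bar>q i - q j\<bar> > int m" if "i \<noteq> j" "i \<noteq> o'" "j \<noteq> o'" for i j
      proof -
        have "\<not> \<bar>q i - q j\<bar> \<le> int m" using nd[OF that(1), of "q i - q j"] by auto
        then show ?thesis by linarith
      qed
      from A B show ?thesis unfolding q_def[symmetric] Let_def by blast
    qed
    show "G \<in> cyclic_spaced m N \<rightarrow> {0..<int N} \<times> spaced m ?S ?L"
    proof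
      fix s :: "'a \<Rightarrow> int" assume s: "s \<in> cyclic_spaced m N"
      define q where "q = (\<lambda>i. (s i - s o') mod int N)"
      have A: "int m < q i \<and> q i < int N - int m" if "i \<noteq> o'" for i
        using key[OF s] that by (auto simp: q_def Let_def)
      have B: "\<bar>q i - q j\<bar> > int m" if "i \<noteq> j" "i \<noteq> o'" "j \<noteq> o'" for i j
        using key[OF s] that by (auto simp: q_def Let_def)
      have "(\<lambda>i\<in>?S. nat (q i - int m - 1)) \<in> spaced m ?S ?L"
        unfolding spaced_def
      proof (intro CollectI conjI ballI impI)
        show "(\<lambda>i\<in>?S. nat (q i - int m - 1)) \<in> ?S \<rightarrow>\<^sub>E {..<?L}"
        proof (rule restrict_PiE_iff[THEN iffD2], rule)
          fix i assume "i \<in> ?S"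
          then show "nat (q i - int m - 1) \<in> {..<?L}" using A[of i] by auto
        qed
        fix i j assume "i \<in> ?S" "j \<in> ?S" "i \<noteq> j"
        then show "(\<lambda>i\<in>?S. nat (q i - int m - 1)) i + m < (\<lambda>i\<in>?S. nat (q i - int m - 1)) j \<or>
            (\<lambda>i\<in>?S. nat (q i - int m - 1)) j + m < (\<lambda>i\<in>?S. nat (q i - int m - 1)) i"
          using A[of i] A[of j] B[of i j] by auto
      qed
      moreover have "s o' \<in> {0..<int N}" using s by (auto simp: cyclic_spaced_def)
      ultimately show "G s \<in> {0..<int N} \<times> spaced m ?S ?L"
        by (simp add: G_def q_def)
    qed
    show "F (G s) = s" if s: "s \<in> cyclic_spaced m N" for s
    proof
      fix i
      have "s i \<in> {0..<int N}" using s by (auto simp: cyclic_spaced_def)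
      moreover have "int m < (s i - s o') mod int N" if "i \<noteq> o'"
        using key[OF s] that by (auto simp: Let_def)
      ultimately show "F (G s) i = s i"
        by (auto simp: F_def G_def mod_simps)
    qed
    show "G (F x) = x" if x: "x \<in> {0..<int N} \<times> spaced m ?S ?L" for x
    proof -
      obtain b g where [simp]: "x = (b, g)" by (cases x)
      have b: "b \<in> {0..<int N}" and g: "g \<in> spaced m ?S ?L" using x by auto
      have "(F x i - F x o') mod int N = ?p g i" if "i \<noteq> o'" for i
      proof -
        have "g i < ?L" using g that by (auto simp: spaced_def)
        then show ?thesis using that by (auto simp: F_def mod_simps intro!: mod_pos_pos_trivial)
      qed
      then have "(\<lambda>i\<in>?S. nat ((F x i - F x o') mod int N - int m - 1)) = (\<lambda>i\<in>?S. g i)"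
        by (intro restrict_ext) auto
      also have "\<dots> = g" using g by (auto simp: spaced_def PiE_def extensional_restrict)
      finally show ?thesis by (simp add: G_def F_def)
    qed
  qed
  then have "card (cyclic_spaced m N :: ('a \<Rightarrow> int) set) = N * card (spaced m ?S ?L)"
    by (simp add: bij_betw_same_card[symmetric] card_cartesian_product)
  with assms show ?thesis by (simp add: card_spaced)
qed

section \<open>Solution sets of equations with gains\<close>

text \<open>
  Equations are kept as syntax because they have to be read over two different fields.
\<close>

datatype 'n equation = Zero 'n | Ratio 'n 'n int

fun sat :: "'f::field \<Rightarrow> ('n \<Rightarrow> 'f) \<Rightarrow> 'n equation \<Rightarrow> bool" where
  "sat b z (Zero i) \<longleftrightarrow> z i = 0"
| "sat b z (Ratio i j k) \<longleftrightarrow> z i = b powi k * z j"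

text \<open>
  A coordinate of a solution is zero or a power of \<open>b\<close> times a free coordinate.
\<close>

fun ev :: "'f::field \<Rightarrow> ('n \<Rightarrow> 'f) \<Rightarrow> ('n \<times> int) option \<Rightarrow> 'f" where
  "ev b z None = 0"
| "ev b z (Some (r, c)) = b powi c * z r"

definition solutions :: "'f::field \<Rightarrow> ('n \<Rightarrow> ('n \<times> int) option) \<Rightarrow> ('n \<Rightarrow> 'f) set" where
  "solutions b \<pi> = {z. \<forall>i. z i = ev b z (\<pi> i)}"

text \<open>
  The coordinates in \<open>R\<close> are free, and all others are expressed through them.
\<close>

definition normal :: "'n set \<Rightarrow> ('n \<Rightarrow> ('n \<times> int) option) \<Rightarrow> bool" where
  "normal R \<pi> \<longleftrightarrow> (\<forall>i r c. \<pi> i = Some (r, c) \<longrightarrow> r \<in> R) \<and> (\<forall>r\<in>R. \<pi> r = Some (r, 0))"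

text \<open>
  Eliminates the free coordinate \<open>r\<close> by means of the equation \<open>z r = ev b z \<tau>\<close>.
\<close>

fun subst_root :: "'n \<Rightarrow> ('n \<times> int) option \<Rightarrow> ('n \<times> int) option \<Rightarrow> ('n \<times> int) option" where
  "subst_root r \<tau> None = None"
| "subst_root r \<tau> (Some (s, c)) = (if s = r then map_option (\<lambda>(t, e). (t, c + e)) \<tau> else Some (s, c))"

lemma ev_shift: "b \<noteq> 0 \<Longrightarrow> ev b z (map_option (\<lambda>(t, e). (t, c + e)) \<tau>) = b powi c * ev b z \<tau>"
  by (cases \<tau>) (auto simp: power_int_add)

lemma subst_root_Some: "subst_root r \<tau> x = Some (t, e) \<Longrightarrow> (\<exists>s c. x = Some (s, c) \<and> s \<noteq> r \<and> t = s) \<or> (\<exists>e. \<tau> = Some (t, e))"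
  by (cases "(r, \<tau>, x)" rule: subst_root.cases) (auto split: if_splits)

lemma normal_root: "normal R \<pi> \<Longrightarrow> \<pi> i = Some (r, c) \<Longrightarrow> r \<in> R"
  by (auto simp: normal_def)

lemma normal_subst_root:
  assumes "normal R \<pi>" "r \<in> R" "\<And>t e. \<tau> = Some (t, e) \<Longrightarrow> t \<in> R - {r}"
  shows "normal (R - {r}) (\<lambda>i. subst_root r \<tau> (\<pi> i))"
  unfolding normal_def
proof (intro conjI allI impI ballI)
  fix i s c assume "subst_root r \<tau> (\<pi> i) = Some (s, c)"
  then consider d where "\<pi> i = Some (s, d)" "s \<noteq> r" | e where "\<tau> = Some (s, e)"
    using subst_root_Some by metis
  then show "s \<in> R - {r}"
    using normal_root[OF assms(1)] assms(3) by cases auto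
next
  fix s assume "s \<in> R - {r}"
  then show "subst_root r \<tau> (\<pi> s) = Some (s, 0)"
    using assms(1) by (simp add: normal_def)
qed

lemma solutions_subst_root:
  assumes "normal R \<pi>" "r \<in> R" "b \<noteq> 0"
  shows "solutions b (\<lambda>i. subst_root r \<tau> (\<pi> i)) = {z \<in> solutions b \<pi>. z r = ev b z \<tau>}"
proof -
  have "map_option (\<lambda>(t, e). (t, 0 + e)) \<tau> = \<tau>" by (cases \<tau>) auto
  then have r: "subst_root r \<tau> (\<pi> r) = \<tau>"
    using assms by (simp add: normal_def)
  have eq: "ev b z (subst_root r \<tau> x) = ev b z x" if "z r = ev b z \<tau>" for z x
  proof (cases x)
    case (Some sc)
    obtain s c where sc: "sc = (s, c)" by (cases sc)
    show ?thesis
    proof (cases "s = r")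
      case True
      then show ?thesis
        unfolding Some sc using that ev_shift[OF assms(3), of z c \<tau>] by simp
    qed (simp add: Some sc)
  qed simp
  show ?thesis
  proof (intro equalityI subsetI)
    fix z assume "z \<in> solutions b (\<lambda>i. subst_root r \<tau> (\<pi> i))"
    then have z: "z i = ev b z (subst_root r \<tau> (\<pi> i))" for i by (simp add: solutions_def)
    from z[of r] have zr: "z r = ev b z \<tau>" by (simp add: r)
    have "z i = ev b z (\<pi> i)" for i
      using z[of i] unfolding eq[OF zr] .
    with zr show "z \<in> {z \<in> solutions b \<pi>. z r = ev b z \<tau>}"
      unfolding solutions_def by blast
  next
    fix z assume "z \<in> {z \<in> solutions b \<pi>. z r = ev b z \<tau>}"
    then have zr: "z r = ev b z \<tau>" and z: "\<And>i. z i = ev b z (\<pi> i)"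
      unfolding solutions_def by blast+
    show "z \<in> solutions b (\<lambda>i. subst_root r \<tau> (\<pi> i))"
      unfolding solutions_def mem_Collect_eq eq[OF zr] using z by blast
  qed
qed

text \<open>
  The powers of \<open>b\<close> with small nonzero exponent differ from one. A real number above one has this
  property for every bound, a primitive root of unity for every bound below its order.
\<close>

definition generic :: "'f::field \<Rightarrow> int \<Rightarrow> bool" where
  "generic b E \<longleftrightarrow> b \<noteq> 0 \<and> (\<forall>e. e \<noteq> 0 \<longrightarrow> \<bar>e\<bar> \<le> E \<longrightarrow> b powi e \<noteq> 1)"

lemma generic_mono: "generic b E \<Longrightarrow> E' \<le> E \<Longrightarrow> generic b E'"
  by (auto simp: generic_def)

text \<open>
  One step of elimination. After insertion of the normal form, an equation is void, or forces a free coordinate to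
  vanish, or identifies one up to a power of \<open>b\<close> with another. The only case distinction that depends
  on \<open>b\<close> is \<open>b\<^sup>d z = b\<^sup>e z\<close>, and genericity up to
  \<open>\<bar>d - e\<bar>\<close> settles it by the exponents alone.
\<close>

lemma sat_reduced:
  fixes c :: "'n equation"
  assumes "normal R \<pi>"
  obtains (redundant) E where "\<And>b z. generic b E \<Longrightarrow> z \<in> solutions b \<pi> \<Longrightarrow> sat (b::'f::field) z c"
  | (substitution) E r \<tau> where "r \<in> R" "\<And>t e. \<tau> = Some (t, e) \<Longrightarrow> t \<in> R - {r}"
      "\<And>b z. generic b E \<Longrightarrow> z \<in> solutions b \<pi> \<Longrightarrow> sat (b::'f::field) z c \<longleftrightarrow> z r = ev b z \<tau>"
proof (cases c)
  case (Zero i)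
  show ?thesis
  proof (cases "\<pi> i")
    case None
    then show ?thesis using Zero by (intro redundant[of 0]) (auto simp: solutions_def)
  next
    case (Some rc)
    then obtain r d where i: "\<pi> i = Some (r, d)" by (cases rc) auto
    have r: "r \<in> R" using assms i by (auto simp: normal_def)
    have "sat b z c \<longleftrightarrow> z r = 0" if "generic b 0" "z \<in> solutions b \<pi>" for b :: 'f and z
    proof -
      have "z i = b powi d * z r" using that(2) i by (metis (mono_tags) ev.simps(2) mem_Collect_eq solutions_def)
      then show ?thesis using that(1) Zero by (auto simp: generic_def)
    qed
    with r show ?thesis by (intro substitution[of r None 0]) auto
  qed
next
  case (Ratio i j k)
  have zi: "z i = ev b z (\<pi> i)" "z j = ev b z (\<pi> j)" if "z \<in> solutions b \<pi>" for b :: 'f and z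
    using that by (auto simp: solutions_def)
  consider "\<pi> i = None" "\<pi> j = None" | r d where "\<pi> i = None" "\<pi> j = Some (r, d)"
    | r d where "\<pi> i = Some (r, d)" "\<pi> j = None"
    | r d e where "\<pi> i = Some (r, d)" "\<pi> j = Some (r, e)"
    | r s d e where "\<pi> i = Some (r, d)" "\<pi> j = Some (s, e)" "r \<noteq> s"
    by (metis not_Some_eq surj_pair)
  then show ?thesis
  proof cases
    case 1
    have "sat b z c" if "z \<in> solutions b \<pi>" for b :: 'f and z
      using zi[OF that] Ratio 1 by simp
    then show ?thesis by (intro redundant)
  next
    case 2
    then have "r \<in> R" using assms by (auto simp: normal_def)
    moreover have "sat b z c \<longleftrightarrow> z r = 0" if "generic b 0" "z \<in> solutions b \<pi>" for b :: 'f and z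
      using zi[OF that(2)] that(1) Ratio 2 by (auto simp: generic_def)
    ultimately show ?thesis by (intro substitution[of r None 0]) auto
  next
    case 3
    then have "r \<in> R" using assms by (auto simp: normal_def)
    moreover have "sat b z c \<longleftrightarrow> z r = 0" if "generic b 0" "z \<in> solutions b \<pi>" for b :: 'f and z
      using zi[OF that(2)] that(1) Ratio 3 by (auto simp: generic_def)
    ultimately show ?thesis by (intro substitution[of r None 0]) auto
  next
    case 4
    then have r: "r \<in> R" using assms by (auto simp: normal_def)
    have *: "sat b z c \<longleftrightarrow> z r = 0 \<or> b powi (d - (k + e)) = 1" if "b \<noteq> 0" "z \<in> solutions b \<pi>" for b :: 'f and z
    proof -
      have "sat b z c \<longleftrightarrow> b powi d * z r = b powi (k + e) * z r"
        using zi[OF that(2)] that(1) Ratio 4 by (simp add: power_int_add mult.assoc)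
      also have "\<dots> \<longleftrightarrow> z r = 0 \<or> b powi (d - (k + e)) = 1"
        using that(1) by (auto simp: power_int_diff)
      finally show ?thesis .
    qed
    show ?thesis
    proof (cases "d = k + e")
      case True
      then show ?thesis using * by (intro redundant[of 0]) (auto simp: generic_def)
    next
      case False
      then show ?thesis using * r
        by (intro substitution[of r None "\<bar>d - (k + e)\<bar>"]) (auto simp: generic_def)
    qed
  next
    case 5
    then have r: "r \<in> R" "s \<in> R" using assms by (auto simp: normal_def)
    have "sat b z c \<longleftrightarrow> z r = ev b z (Some (s, k + e - d))" if "generic b 0" "z \<in> solutions b \<pi>" for b :: 'f and z
    proof -
      have b: "b \<noteq> 0" using that(1) by (simp add: generic_def)
      have "sat b z c \<longleftrightarrow> b powi d * z r = b powi (k + e) * z s"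
        using zi[OF that(2)] b Ratio 5 by (simp add: power_int_add mult.assoc)
      also have "\<dots> \<longleftrightarrow> z r = b powi (k + e - d) * z s"
        using b by (simp add: power_int_diff field_simps)
      finally show ?thesis by simp
    qed
    with r 5(3) show ?thesis by (intro substitution[of r "Some (s, k + e - d)" 0]) auto
  qed
qed

text \<open>
  The point is the order of quantifiers: the normal form depends only on the equations and serves every generic
  \<open>b\<close> at once.
\<close>

lemma solution_normal_form:
  fixes B :: "'n equation set"
  assumes "finite B"
  shows "\<exists>R \<pi> E. normal R \<pi> \<and> (\<forall>b::'f::field. generic b E \<longrightarrow> {z. \<forall>c\<in>B. sat b z c} = solutions b \<pi>)"
  using assms
proof (induction B)
  case empty
  have "normal UNIV (\<lambda>i::'n. Some (i, 0))" by (simp add: normal_def)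
  moreover have "solutions b (\<lambda>i::'n. Some (i, 0)) = UNIV" for b :: 'f by (simp add: solutions_def)
  ultimately show ?case by (auto intro!: exI)
next
  case (insert c B)
  then obtain R \<pi> E where IH: "normal R \<pi>"
    "\<And>b::'f. generic b E \<Longrightarrow> {z. \<forall>c\<in>B. sat b z c} = solutions b \<pi>" by blast
  have split: "{z. \<forall>c\<in>insert c B. sat b z c} = {z \<in> {z. \<forall>c\<in>B. sat b z c}. sat b z c}" for b :: 'f
    by auto
  from IH(1) show ?case
  proof (cases rule: sat_reduced[where c = c and 'f = 'f])
    case (redundant E')
    have "{z. \<forall>c\<in>insert c B. sat b z c} = solutions b \<pi>" if "generic b (max E E')" for b :: 'f
      using redundant[of b] IH(2)[of b] generic_mono[OF that, of E] generic_mono[OF that, of E']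
      unfolding split by auto
    with IH(1) show ?thesis by (intro exI conjI allI impI)
  next
    case (substitution E' r \<tau>)
    have "{z. \<forall>c\<in>insert c B. sat b z c} = solutions b (\<lambda>i. subst_root r \<tau> (\<pi> i))"
      if "generic b (max E E')" for b :: 'f
    proof -
      have "b \<noteq> 0" using that by (simp add: generic_def)
      then show ?thesis
        using substitution(3)[of b] IH(2)[of b] generic_mono[OF that, of E] generic_mono[OF that, of E']
        unfolding split solutions_subst_root[OF IH(1) substitution(1) \<open>b \<noteq> 0\<close>]
        by (metis (no_types, lifting) Collect_cong max.cobounded1 max.cobounded2)
    qed
    moreover have "normal (R - {r}) (\<lambda>i. subst_root r \<tau> (\<pi> i))"
      using normal_subst_root[OF IH(1) substitution(1,2)] .
    ultimately show ?thesis by (intro exI conjI allI impI)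
  qed
qed

lemma card_solutions:
  fixes M :: "'f::field set" and \<pi> :: "'n::finite \<Rightarrow> ('n \<times> int) option"
  assumes "normal R \<pi>" "0 \<in> M" "\<And>c x. x \<in> M \<Longrightarrow> b powi c * x \<in> M"
  shows "card {z \<in> UNIV \<rightarrow> M. z \<in> solutions b \<pi>} = card M ^ card R"
proof -
  let ?f = "\<lambda>z. restrict z R" and ?g = "\<lambda>y i. ev b y (\<pi> i)"
  have ev_cong: "ev b y (\<pi> i) = ev b z (\<pi> i)" if "\<And>r. r \<in> R \<Longrightarrow> y r = z r" for y z i
    using that normal_root[OF assms(1), of i] by (cases "(b, y, \<pi> i)" rule: ev.cases) auto
  have g: "?g y r = y r" if "r \<in> R" for y r
    using assms(1) that by (simp add: normal_def)
  have "bij_betw ?f {z \<in> UNIV \<rightarrow> M. z \<in> solutions b \<pi>} (R \<rightarrow>\<^sub>E M)"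
  proof (rule bij_betwI[where g = ?g])
    show "?g \<in> (R \<rightarrow>\<^sub>E M) \<rightarrow> {z \<in> UNIV \<rightarrow> M. z \<in> solutions b \<pi>}"
    proof
      fix y assume y: "y \<in> R \<rightarrow>\<^sub>E M"
      have "ev b y (\<pi> i) \<in> M" for i
        using y assms(2,3) normal_root[OF assms(1), of i]
        by (cases "(b, y, \<pi> i)" rule: ev.cases) auto
      moreover have "?g y \<in> solutions b \<pi>"
        unfolding solutions_def using ev_cong[of "?g y" y] g by simp
      ultimately show "?g y \<in> {z \<in> UNIV \<rightarrow> M. z \<in> solutions b \<pi>}" by simp
    qed
    show "?g (?f z) = z" if "z \<in> {z \<in> UNIV \<rightarrow> M. z \<in> solutions b \<pi>}" for z
      using that ev_cong[of "?f z" z] by (auto simp: solutions_def)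
    show "?f (?g y) = y" if "y \<in> R \<rightarrow>\<^sub>E M" for y
      using that g by (auto simp: PiE_def extensional_def fun_eq_iff)
  qed auto
  then show ?thesis
    by (simp add: bij_betw_same_card card_funcsetE)
qed

text \<open>
  The normal form is a linear isomorphism from a coordinate subspace onto the solution space.
\<close>

lemma aff_dim_solutions:
  fixes b :: real and \<pi> :: "'n::finite \<Rightarrow> ('n \<times> int) option"
  assumes "normal R \<pi>"
  shows "aff_dim {x :: real ^ 'n. ($) x \<in> solutions b \<pi>} = int (card R)"
proof -
  let ?T = "\<lambda>x :: real ^ 'n. \<chi> i. ev b (($) x) (\<pi> i)"
  let ?S = "{x :: real ^ 'n. \<forall>i. i \<notin> R \<longrightarrow> x $ i = 0}"
  have ev_lin: "ev b (($) (x + y)) p = ev b (($) x) p + ev b (($) y) p"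
    "ev b (($) (c *\<^sub>R x)) p = c * ev b (($) x) p" for x y :: "real ^ 'n" and c p
    by (cases "(b, ($) x, p)" rule: ev.cases; simp add: algebra_simps)+
  have ev_cong: "ev b y (\<pi> i) = ev b z (\<pi> i)" if "\<And>r. r \<in> R \<Longrightarrow> y r = z r" for y z i
    using that normal_root[OF assms(1), of i] by (cases "(b, y, \<pi> i)" rule: ev.cases) auto
  have T: "?T x $ r = x $ r" if "r \<in> R" for x r
    using assms that by (simp add: normal_def)
  have lin: "linear ?T"
    by (rule linearI) (simp_all add: vec_eq_iff ev_lin)
  have S: "subspace ?S" by (auto simp: subspace_def)
  have inj: "inj_on ?T (span ?S)"
  proof -
    have "x = y" if "x \<in> ?S" "y \<in> ?S" "?T x = ?T y" for x y
    proof -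
      have "x $ i = y $ i" for i
      proof (cases "i \<in> R")
        case True
        then show ?thesis using T[of i x] T[of i y] that(3) by simp
      qed (use that in simp)
      then show ?thesis by (simp add: vec_eq_iff)
    qed
    then show ?thesis using S by (simp add: inj_on_def span_eq_iff[THEN iffD2])
  qed
  have img: "{x :: real ^ 'n. ($) x \<in> solutions b \<pi>} = ?T ` ?S"
  proof (intro equalityI subsetI)
    fix x :: "real ^ 'n" assume "x \<in> {x. ($) x \<in> solutions b \<pi>}"
    then have x: "x $ i = ev b (($) x) (\<pi> i)" for i by (simp add: solutions_def)
    define y :: "real ^ 'n" where "y = (\<chi> i. if i \<in> R then x $ i else 0)"
    have "?T y = x"
      using x ev_cong[of "($) y" "($) x"] by (simp add: vec_eq_iff y_def)
    moreover have "y \<in> ?S" by (simp add: y_def)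
    ultimately show "x \<in> ?T ` ?S" by blast
  next
    fix x assume "x \<in> ?T ` ?S"
    then obtain y where y: "x = ?T y" by blast
    have "ev b (($) x) (\<pi> i) = ev b (($) y) (\<pi> i)" for i
      using T[of _ y] y by (intro ev_cong) simp
    then show "x \<in> {x. ($) x \<in> solutions b \<pi>}"
      by (simp add: solutions_def y)
  qed
  have sub: "subspace (?T ` ?S)" using lin S by (rule linear_subspace_image)
  have "dim (?T ` ?S) = dim ?S"
    using lin inj by (rule dim_image_eq)
  also have "\<dots> = card R" using dim_substandard_cart[of R, where 'a = real] by (simp add: dim_vec_eq)
  finally show ?thesis unfolding img by (simp add: aff_dim_subspace[OF sub])
qed

section \<open>Characteristic polynomials by counting in finite models\<close>

text \<open>
  The defining recursion of the Moebius function in summed form. The flats below \<open>y\<close> in the poset are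
  those that contain \<open>y\<close>.
\<close>

lemma sum_mobius_above:
  fixes P :: "'a set set"
  assumes "finite P" "UNIV \<in> P" "y \<in> P"
  shows "(\<Sum>x | x \<in> P \<and> y \<subseteq> x. mobius P (reverse_inclusion P) UNIV x) = (if y = UNIV then 1 else 0)"
proof -
  have r: "(UNIV, x) \<in> reverse_inclusion P \<longleftrightarrow> x \<in> P" for x
    using assms by (simp add: reverse_inclusion_def)
  show ?thesis
  proof (cases "y = UNIV")
    case True
    have "mobius P (reverse_inclusion P) UNIV UNIV = 1"
      using assms by (subst mobius.simps) (simp add: partial_order_on_reverse_inclusion r)
    moreover have "{x. x \<in> P \<and> y \<subseteq> x} = {UNIV}" using assms True by auto
    ultimately show ?thesis using True by simp
  next
    case False
    let ?\<mu> = "mobius P (reverse_inclusion P) UNIV"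
    have "?\<mu> y = - (\<Sum>z\<in>{z \<in> P. (UNIV, z) \<in> reverse_inclusion P \<and> (z, y) \<in> reverse_inclusion P \<and> z \<noteq> y}. ?\<mu> z)"
      using assms False
      by (subst mobius.simps) (simp add: partial_order_on_reverse_inclusion r)
    also have "{z \<in> P. (UNIV, z) \<in> reverse_inclusion P \<and> (z, y) \<in> reverse_inclusion P \<and> z \<noteq> y} =
        {x. x \<in> P \<and> y \<subseteq> x} - {y}"
      using assms by (auto simp: reverse_inclusion_def)
    finally have "?\<mu> y = - (\<Sum>x\<in>{x. x \<in> P \<and> y \<subseteq> x} - {y}. ?\<mu> x)" .
    moreover have "(\<Sum>x\<in>{x. x \<in> P \<and> y \<subseteq> x}. ?\<mu> x) = ?\<mu> y + (\<Sum>x\<in>{x. x \<in> P \<and> y \<subseteq> x} - {y}. ?\<mu> x)"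
      using assms by (intro sum.remove) auto
    ultimately show ?thesis using False by simp
  qed
qed

text \<open>
  The finite field method in abstract form. Each model point \<open>z\<close> generates a flat \<open>X z\<close>,
  the intersection of the hyperplanes through it. The counting hypothesis implies that \<open>z\<close> satisfies
  everything that follows from its own equations: if \<open>X z\<close> lies in a further hyperplane, then adding
  this hyperplane changes neither the flat nor the number of its model points, hence not the set of these. So the
  model points of a flat \<open>x\<close> are the \<open>z\<close> with \<open>X z \<subseteq> x\<close>, and
  summing the Moebius function over all pairs leaves the points with \<open>X z = UNIV\<close>.
\<close>

theorem characteristic_poly_finite_model:
  fixes H :: "'c \<Rightarrow> 'v::euclidean_space set" and \<sigma> :: "'z \<Rightarrow> 'c \<Rightarrow> bool"
  assumes fin: "finite K" "finite Z"
    and central: "\<And>c. c \<in> K \<Longrightarrow> x0 \<in> H c"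
    and proper: "\<And>c. c \<in> K \<Longrightarrow> H c \<noteq> UNIV"
    and card: "\<And>B. B \<subseteq> K \<Longrightarrow> card {z \<in> Z. \<forall>c\<in>B. \<sigma> z c} = q ^ nat (aff_dim (\<Inter>(H ` B)))"
  shows "poly (characteristic_poly (H ` K)) (int q) = int (card {z \<in> Z. \<forall>c\<in>K. \<not> \<sigma> z c})"
proof -
  define P where "P = flats (H ` K)"
  define X where "X = (\<lambda>z. \<Inter>(H ` {c \<in> K. \<sigma> z c}))"
  let ?\<mu> = "mobius P (reverse_inclusion P) UNIV"
  have flat: "\<Inter>(H ` B) \<in> P" if "B \<subseteq> K" for B
    using that central by (auto simp: P_def flats_def)
  have flatE: "\<exists>B\<subseteq>K. x = \<Inter>(H ` B)" if "x \<in> P" for x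
    using that by (auto simp: P_def flats_def subset_image_iff)
  have finP: "finite P" unfolding P_def using fin by (intro finite_flats) auto
  have U: "UNIV \<in> P" using flat[of "{}"] by simp
  have X: "X z \<in> P" for z unfolding X_def by (intro flat) auto
  have sub_iff: "X z \<subseteq> \<Inter>(H ` B) \<longleftrightarrow> (\<forall>c\<in>B. \<sigma> z c)" if "B \<subseteq> K" "z \<in> Z" for B z
  proof
    assume "\<forall>c\<in>B. \<sigma> z c"
    with that show "X z \<subseteq> \<Inter>(H ` B)" by (auto simp: X_def)
  next
    let ?S = "{c \<in> K. \<sigma> z c}"
    assume "X z \<subseteq> \<Inter>(H ` B)"
    then have "\<Inter>(H ` (?S \<union> B)) = \<Inter>(H ` ?S)"
      by (auto simp: X_def)
    then have "card {z \<in> Z. \<forall>c\<in>?S \<union> B. \<sigma> z c} = card {z \<in> Z. \<forall>c\<in>?S. \<sigma> z c}"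
      using card[of "?S \<union> B"] card[of ?S] that(1) by simp
    then have "{z \<in> Z. \<forall>c\<in>?S \<union> B. \<sigma> z c} = {z \<in> Z. \<forall>c\<in>?S. \<sigma> z c}"
      using fin by (intro card_subset_eq) auto
    with that(2) show "\<forall>c\<in>B. \<sigma> z c" by blast
  qed
  have X_UNIV: "X z = UNIV \<longleftrightarrow> (\<forall>c\<in>K. \<not> \<sigma> z c)" for z
    using proper by (auto simp: X_def)
  have "poly (characteristic_poly (H ` K)) (int q) = (\<Sum>x\<in>P. ?\<mu> x * int q ^ nat (aff_dim x))"
    by (simp add: characteristic_poly_def P_def poly_sum poly_monom)
  also have "\<dots> = (\<Sum>x\<in>P. ?\<mu> x * int (card {z \<in> Z. X z \<subseteq> x}))"
  proof (intro sum.cong refl)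
    fix x assume "x \<in> P"
    then obtain B where B: "B \<subseteq> K" "x = \<Inter>(H ` B)" using flatE by blast
    have "{z \<in> Z. X z \<subseteq> x} = {z \<in> Z. \<forall>c\<in>B. \<sigma> z c}" using sub_iff[OF B(1)] B(2) by blast
    with card[OF B(1)] B(2) show "?\<mu> x * int q ^ nat (aff_dim x) = ?\<mu> x * int (card {z \<in> Z. X z \<subseteq> x})"
      by simp
  qed
  also have "\<dots> = (\<Sum>x\<in>P. \<Sum>z\<in>Z. if X z \<subseteq> x then ?\<mu> x else 0)"
    using fin by (simp add: sum.If_cases Int_def mult.commute)
  also have "\<dots> = (\<Sum>z\<in>Z. \<Sum>x\<in>P. if X z \<subseteq> x then ?\<mu> x else 0)"
    by (rule sum.swap)
  also have "\<dots> = (\<Sum>z\<in>Z. if X z = UNIV then 1 else 0)"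
  proof (intro sum.cong refl)
    fix z
    have "(\<Sum>x\<in>P. if X z \<subseteq> x then ?\<mu> x else 0) = (\<Sum>x | x \<in> P \<and> X z \<subseteq> x. ?\<mu> x)"
      using finP by (simp add: sum.inter_filter)
    with sum_mobius_above[OF finP U X] show "(\<Sum>x\<in>P. if X z \<subseteq> x then ?\<mu> x else 0) = (if X z = UNIV then 1 else 0)"
      by simp
  qed
  also have "\<dots> = int (card {z \<in> Z. X z = UNIV})"
    using fin by (simp add: sum.If_cases Int_def)
  finally show ?thesis by (simp add: X_UNIV)
qed

section \<open>The model on roots of unity\<close>

definition unit_root :: "nat \<Rightarrow> complex" where
  "unit_root N = cis (2 * pi / real N)"

lemma unit_root_nonzero [simp]: "unit_root N \<noteq> 0" by (simp add: unit_root_def)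

lemma unit_root_powi_eq_1_iff:
  assumes "N > 0"
  shows "unit_root N powi k = 1 \<longleftrightarrow> int N dvd k"
proof -
  have "unit_root N powi k = 1 \<longleftrightarrow> (\<exists>n. of_int k * (2 * pi / real N) = of_int n * (2 * pi))"
    by (simp add: unit_root_def cis_power_int cis_eq_1_iff)
  also have "\<dots> \<longleftrightarrow> (\<exists>n. k = int N * n)"
  proof (intro arg_cong[where f = Ex] ext)
    fix n
    have "of_int k * (2 * pi / real N) = of_int n * (2 * pi) \<longleftrightarrow> real_of_int k = real_of_int (int N * n)"
      using assms by (simp add: field_simps)
    then show "(of_int k * (2 * pi / real N) = of_int n * (2 * pi)) = (k = int N * n)"
      by (simp only: of_int_eq_iff)
  qed
  finally show ?thesis by (simp add: dvd_def)
qed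

lemma unit_root_powi_eq_iff:
  assumes "N > 0"
  shows "unit_root N powi j = unit_root N powi k \<longleftrightarrow> int N dvd j - k"
  using unit_root_powi_eq_1_iff[OF assms, of "j - k"] by (simp add: power_int_diff)

text \<open>
  The field with \<open>N + 1\<close> elements in the finite field method is used only through its multiplicative
  structure, so zero together with a cyclic group takes its place, and no primality is involved.
\<close>

definition model_values :: "nat \<Rightarrow> complex set" where
  "model_values N = insert 0 ((\<lambda>k. unit_root N powi k) ` {0..<int N})"

lemma model_values_closed:
  assumes "N > 0" "x \<in> model_values N"
  shows "unit_root N powi c * x \<in> model_values N"
proof (cases "x = 0")
  case False
  then obtain k where "x = unit_root N powi k" using assms by (auto simp: model_values_def)
  then have "unit_root N powi c * x = unit_root N powi ((c + k) mod int N)"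
    using unit_root_powi_eq_iff[OF assms(1), of "c + k" "(c + k) mod int N"]
    by (simp add: power_int_add)
  then show ?thesis using assms(1) by (simp add: model_values_def)
qed (simp add: model_values_def)

lemma inj_unit_root_powi: "N > 0 \<Longrightarrow> inj_on (\<lambda>k. unit_root N powi k) {0..<int N}"
  by (rule inj_onI) (auto simp: unit_root_powi_eq_iff mod_eq_dvd_iff[symmetric])

lemma card_model_values: "N > 0 \<Longrightarrow> card (model_values N) = N + 1"
  unfolding model_values_def by (subst card_insert_disjoint) (auto simp: card_image inj_unit_root_powi)

lemma generic_unit_root: "int N > E \<Longrightarrow> N > 0 \<Longrightarrow> generic (unit_root N) E"
  by (auto simp: generic_def unit_root_powi_eq_1_iff dest!: dvd_imp_le_int)

lemma generic_real:
  fixes a :: real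
  assumes "a > 1"
  shows "generic (complex_of_real a) E"
proof -
  have "a powi e \<noteq> 1" if "e \<noteq> 0" for e
    using assms that power_int_strict_increasing[of 0 e a] power_int_strict_increasing[of e 0 a]
    by (cases "e > 0") auto
  then show ?thesis using assms
    by (auto simp: generic_def of_real_power_int[symmetric] simp del: of_real_power_int)
qed

definition hyperplane :: "real \<Rightarrow> 'n equation \<Rightarrow> (real ^ 'n::finite) set" where
  "hyperplane a c = {x. sat a (($) x) c}"

definition equations :: "nat \<Rightarrow> 'n::{finite,linorder} equation set" where
  "equations m = range Zero \<union> {Ratio i j k | i j k. i < j \<and> k \<in> {- int m..int m}}"

lemma arrangement_eq: "arrangement a m = (hyperplane a ` equations m :: (real ^ 'n::{finite,linorder}) set set)"
proof -
  have "hyperplane a (Zero i) = {x :: real ^ 'n::{finite,linorder}. x $ i = 0}"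
    "hyperplane a (Ratio i j k) = {x :: real ^ 'n::{finite,linorder}. x $ i = a powi k * x $ j}" for i j k
    by (simp_all add: hyperplane_def)
  note eq = this[symmetric]
  show ?thesis
    unfolding arrangement_def equations_def eq image_Un by blast
qed

lemma finite_equations: "finite (equations m)"
proof -
  have "equations m \<subseteq> range Zero \<union> (\<Union>i. \<Union>j. Ratio i j ` {- int m..int m})"
    unfolding equations_def by blast
  then show ?thesis by (rule finite_subset) simp
qed

lemma sat_of_real: "sat (complex_of_real a) (\<lambda>i. of_real (z i)) c \<longleftrightarrow> sat a z c"
  by (cases c) (auto simp: of_real_power_int[symmetric] of_real_mult[symmetric] simp del: of_real_power_int of_real_mult)

lemma ev_of_real: "ev (complex_of_real a) (\<lambda>i. of_real (z i)) p = of_real (ev a z p)"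
  by (cases "(a, z, p)" rule: ev.cases) auto

lemma solutions_of_real: "(\<lambda>i. of_real (z i)) \<in> solutions (complex_of_real a) \<pi> \<longleftrightarrow> z \<in> solutions a \<pi>"
  by (simp add: solutions_def ev_of_real)

text \<open>
  Embedding the reals into the complex numbers puts both systems of equations over one field, so that both sides
  are read off from the same normal form. The bound on \<open>N\<close> comes from the exponents that occur in the
  elimination.
\<close>

lemma card_model_flat:
  fixes B :: "'n::finite equation set"
  assumes "finite B" "a > 1"
  shows "eventually (\<lambda>N. card {z \<in> UNIV \<rightarrow> model_values N. \<forall>c\<in>B. sat (unit_root N) z c} =
           (N + 1) ^ nat (aff_dim (\<Inter>(hyperplane a ` B)))) at_top"
proof -
  obtain R \<pi> E where nf: "normal R \<pi>"
    "\<And>b::complex. generic b E \<Longrightarrow> {z. \<forall>c\<in>B. sat b z c} = solutions b \<pi>"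
    using solution_normal_form[OF assms(1), where 'f = complex] by blast
  have "\<Inter>(hyperplane a ` B) = {x. ($) x \<in> solutions a \<pi>}"
  proof -
    have "x \<in> \<Inter>(hyperplane a ` B) \<longleftrightarrow> (\<lambda>i. complex_of_real (x $ i)) \<in> {z. \<forall>c\<in>B. sat (complex_of_real a) z c}" for x
      by (simp add: hyperplane_def sat_of_real)
    then show ?thesis
      unfolding nf(2)[OF generic_real[OF assms(2)]] solutions_of_real by blast
  qed
  then have dim: "nat (aff_dim (\<Inter>(hyperplane a ` B))) = card R"
    by (simp add: aff_dim_solutions[OF nf(1)])
  show ?thesis
  proof (rule eventually_mono[OF eventually_gt_at_top])
    fix N assume N: "N > nat E"
    then have "generic (unit_root N) E" by (intro generic_unit_root) auto
    from nf(2)[OF this] have "{z \<in> UNIV \<rightarrow> model_values N. \<forall>c\<in>B. sat (unit_root N) z c} =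
        {z \<in> UNIV \<rightarrow> model_values N. z \<in> solutions (unit_root N) \<pi>}"
      by blast
    also have "card \<dots> = (N + 1) ^ card R"
      using N card_solutions[OF nf(1), of "model_values N" "unit_root N"] model_values_closed[of N] card_model_values[of N]
      by (simp add: model_values_def)
    finally show "card {z \<in> UNIV \<rightarrow> model_values N. \<forall>c\<in>B. sat (unit_root N) z c} =
           (N + 1) ^ nat (aff_dim (\<Inter>(hyperplane a ` B)))"
      by (simp only: dim)
  qed
qed

text \<open>
  Points off the coordinate hyperplanes are \<open>N\<close>-th roots of unity in every coordinate; their
  exponents are the positions on the cycle.
\<close>

lemma card_model_complement:
  assumes "N > 0"
  shows "card {z \<in> UNIV \<rightarrow> model_values N. \<forall>c\<in>(equations m :: 'n equation set). \<not> sat (unit_root N) z c} =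
         card (cyclic_spaced m N :: ('n::{finite,linorder} \<Rightarrow> int) set)"
proof -
  let ?f = "\<lambda>s i. unit_root N powi s i"
  have sat_iff: "sat (unit_root N) (?f s) (Ratio i j k) \<longleftrightarrow> int N dvd s i - s j - k" for s :: "'n \<Rightarrow> int" and i j k
    using unit_root_powi_eq_iff[OF assms, of "s i" "k + s j"]
    by (simp add: power_int_add diff_diff_add add.commute)
  have avoid: "(\<forall>c\<in>equations m. \<not> sat (unit_root N) (?f s) c) \<longleftrightarrow>
      (\<forall>i j k. i \<noteq> j \<longrightarrow> \<bar>k\<bar> \<le> int m \<longrightarrow> \<not> int N dvd s i - s j - k)" for s :: "'n \<Rightarrow> int"
  proof
    assume L: "\<forall>c\<in>equations m. \<not> sat (unit_root N) (?f s) c"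
    have lt: "\<not> int N dvd s i - s j - k" if "i < j" "\<bar>k\<bar> \<le> int m" for i j k
    proof -
      have "Ratio i j k \<in> equations m" using that by (auto simp: equations_def)
      with L show ?thesis using sat_iff by blast
    qed
    have "\<not> int N dvd s i - s j - k" if ij: "i \<noteq> j" and k: "\<bar>k\<bar> \<le> int m" for i j k
    proof (cases "i < j")
      case False
      then have "\<not> int N dvd s j - s i - (- k)" using lt[of j i "- k"] ij k by auto
      moreover have "s j - s i - (- k) = - (s i - s j - k)" by simp
      ultimately show ?thesis by (metis dvd_minus_iff)
    qed (use lt k in blast)
    then show "\<forall>i j k. i \<noteq> j \<longrightarrow> \<bar>k\<bar> \<le> int m \<longrightarrow> \<not> int N dvd s i - s j - k" by blast
  next
    assume R: "\<forall>i j k. i \<noteq> j \<longrightarrow> \<bar>k\<bar> \<le> int m \<longrightarrow> \<not> int N dvd s i - s j - k"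
    show "\<forall>c\<in>equations m. \<not> sat (unit_root N) (?f s) c"
    proof
      fix c :: "'n equation" assume "c \<in> equations m"
      then consider i where "c = Zero i" | i j k where "c = Ratio i j k" "i < j" "\<bar>k\<bar> \<le> int m"
        by (auto simp: equations_def)
      then show "\<not> sat (unit_root N) (?f s) c"
      proof cases
        case 2
        have "\<not> int N dvd s i - s j - k" using R[rule_format, of i j k] 2(2,3) by simp
        then show ?thesis unfolding 2(1) sat_iff .
      qed simp
    qed
  qed
  have "inj_on ?f (cyclic_spaced m N :: ('n \<Rightarrow> int) set)"
  proof (rule inj_onI, rule ext)
    fix s s' :: "'n \<Rightarrow> int" and i
    assume s: "s \<in> cyclic_spaced m N" "s' \<in> cyclic_spaced m N" and eq: "?f s = ?f s'"
    have "s i \<in> {0..<int N}" "s' i \<in> {0..<int N}"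
      using s by (auto simp: cyclic_spaced_def)
    moreover have "unit_root N powi s i = unit_root N powi s' i"
      using fun_cong[OF eq, of i] by simp
    ultimately show "s i = s' i"
      using inj_onD[OF inj_unit_root_powi[OF assms]] by simp
  qed
  moreover have "?f ` cyclic_spaced m N = {z \<in> UNIV \<rightarrow> model_values N. \<forall>c\<in>(equations m :: 'n equation set). \<not> sat (unit_root N) z c}"
  proof (intro equalityI subsetI)
    fix z :: "'n \<Rightarrow> complex" assume "z \<in> ?f ` cyclic_spaced m N"
    then obtain s where s: "s \<in> cyclic_spaced m N" "z = ?f s" by blast
    have "s i \<in> {0..<int N}" for i using s by (auto simp: cyclic_spaced_def)
    then have "z \<in> UNIV \<rightarrow> model_values N" unfolding s(2) model_values_def by blast
    moreover have "\<forall>c\<in>equations m. \<not> sat (unit_root N) z c"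
      unfolding s(2) avoid using s(1) by (simp add: cyclic_spaced_def)
    ultimately show "z \<in> {z \<in> UNIV \<rightarrow> model_values N. \<forall>c\<in>equations m. \<not> sat (unit_root N) z c}" by blast
  next
    fix z :: "'n \<Rightarrow> complex" assume z: "z \<in> {z \<in> UNIV \<rightarrow> model_values N. \<forall>c\<in>equations m. \<not> sat (unit_root N) z c}"
    have "\<exists>k\<in>{0..<int N}. z i = unit_root N powi k" for i
    proof -
      have "Zero i \<in> equations m" by (simp add: equations_def)
      then have "z i \<noteq> 0" using z by force
      moreover have "z i \<in> model_values N" using z by auto
      ultimately show ?thesis by (auto simp: model_values_def)
    qed
    then obtain s where s: "\<And>i. s i \<in> {0..<int N}" "\<And>i. z i = unit_root N powi s i" by metis
    have zs: "z = ?f s" using s(2) by blast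
    have "\<forall>c\<in>equations m. \<not> sat (unit_root N) (?f s) c" using z unfolding zs by blast
    then have "s \<in> cyclic_spaced m N" unfolding avoid using s(1) by (auto simp: cyclic_spaced_def)
    with zs show "z \<in> ?f ` cyclic_spaced m N" by blast
  qed
  ultimately show ?thesis by (metis card_image)
qed

lemma hyperplane_proper: "c \<in> equations m \<Longrightarrow> hyperplane a c \<noteq> UNIV"
proof -
  assume "c \<in> equations m"
  then have "\<exists>i. axis i 1 \<notin> hyperplane a c"
    by (auto simp: equations_def hyperplane_def axis_def)
  then show ?thesis by blast
qed

text \<open>
  The bound on \<open>N\<close> makes all natural number subtractions exact, so that the falling factorial becomes
  a Pochhammer symbol at negative argument.
\<close>

lemma card_cyclic_spaced_rothe:
  assumes "CARD('n::finite) = n" "n > 0" "N > (2 * m + 2) * n"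
  shows "int (card (cyclic_spaced m N :: ('n \<Rightarrow> int) set)) = (-1) ^ n * rothe m n (- int N)"
proof -
  obtain k where k: "n = Suc k" using assms(2) by (cases n) auto
  have N: "N > 2 * m" using assms(3) unfolding k by (simp add: algebra_simps)
  have "int (fact k * (x choose k)) = (-1) ^ k * pochhammer (- int x) k" for x
  proof -
    have "real (x choose k) = (-1) ^ k * pochhammer (- real x) k / fact k"
      using gbinomial_pochhammer[of "real x" k] by (simp add: binomial_gbinomial)
    then have "real_of_int (int (fact k * (x choose k))) = real_of_int ((-1) ^ k * pochhammer (- int x) k)"
      using pochhammer_of_int[of "- int x" k, where 'a = real] by simp
    then show ?thesis by (simp only: of_int_eq_iff)
  qed
  moreover have "- int (N - 1 - 2 * m - m * (k - 1)) = - int N + int (m * n + 1)" if "k \<noteq> 0"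
  proof -
    obtain l where l: "k = Suc l" using \<open>k \<noteq> 0\<close> by (cases k) auto
    have "m * n = 2 * m + m * l" using k l by (simp add: algebra_simps)
    moreover have "1 + 2 * m + m * l \<le> N" using assms(3) unfolding k l by (simp add: algebra_simps)
    ultimately show ?thesis using l by (simp add: of_nat_diff)
  qed
  ultimately show ?thesis
    using card_cyclic_spaced[OF N, where 'a = 'n, of k] assms(1) k
    by (cases "k = 0") (simp_all add: rothe_def)
qed

section \<open>Comparison of the two polynomials\<close>

theorem theorem4p3:
  fixes a :: real and m n j :: nat
  assumes "m \<ge> 1" and "n \<ge> 1" and "CARD('n::{finite,linorder}) = n"
    and "a > 1" and "j \<le> n"
  shows "\<bar>coeff (characteristic_poly (arrangement a m :: (real ^ 'n::{finite,linorder}) set set)) j\<bar> =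
         int (card {(w, i) \<in> decorated_dyck_paths m n. num_compartments m (drop i w) = j})"
proof -
  let ?K = "equations m :: 'n equation set"
  let ?\<chi> = "characteristic_poly (arrangement a m :: (real ^ 'n::{finite,linorder}) set set)"
  define P :: "int poly" where "P = rothe m n [:1, 1:]"
  \<comment> \<open>The substitution of \<open>-t\<close> changes coefficients only by signs.\<close>
  define Q where "Q = smult ((-1) ^ n) (pcompose P [:0, -1:])"
  have poly_rothe: "poly (rothe m n p) x = rothe m n (poly p x)" for p and x :: int
    by (simp add: rothe_def pochhammer_prod poly_prod)
  have "eventually (\<lambda>N. \<forall>B\<in>Pow ?K. card {z \<in> UNIV \<rightarrow> model_values N. \<forall>c\<in>B. sat (unit_root N) z c} =
           (N + 1) ^ nat (aff_dim (\<Inter>(hyperplane a ` B)))) at_top"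
    using assms(4) finite_equations finite_subset[OF _ finite_equations]
    by (intro eventually_ball_finite ballI card_model_flat) auto
  then have "eventually (\<lambda>N. poly ?\<chi> (int (N + 1)) = poly Q (int (N + 1))) at_top"
    using eventually_gt_at_top[of "(2 * m + 2) * n"]
  proof eventually_elim
    case (elim N)
    have "finite (UNIV \<rightarrow> model_values N :: ('n \<Rightarrow> complex) set)"
      using finite_PiE[of UNIV "\<lambda>_ :: 'n. model_values N"] by (simp add: model_values_def PiE_UNIV_domain)
    then have "poly ?\<chi> (int (N + 1)) =
        int (card {z \<in> UNIV \<rightarrow> model_values N. \<forall>c\<in>?K. \<not> sat (unit_root N) z c})"
      unfolding arrangement_eq
    proof (intro characteristic_poly_finite_model[where ?x0.0 = 0])
      fix c :: "'n equation"
      show "0 \<in> hyperplane a c" by (cases c) (auto simp: hyperplane_def)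
    qed (use elim in \<open>auto simp: finite_equations hyperplane_proper\<close>)
    also have "\<dots> = (-1) ^ n * rothe m n (- int N)"
      using elim(2) assms(2,3) card_model_complement[of N m, where 'n = 'n]
        card_cyclic_spaced_rothe[of n m N, where 'n = 'n] by simp
    also have "\<dots> = poly Q (int (N + 1))"
      by (simp add: Q_def P_def poly_pcompose poly_rothe)
    finally show ?case .
  qed
  then obtain N0 where N0: "\<And>N. N \<ge> N0 \<Longrightarrow> poly ?\<chi> (int (N + 1)) = poly Q (int (N + 1))"
    by (auto simp: eventually_at_top_linorder)
  have "?\<chi> = Q"
  proof (rule ccontr)
    assume "?\<chi> \<noteq> Q"
    then have "finite {x. poly (?\<chi> - Q) x = 0}" by (intro poly_roots_finite) simp
    moreover have "(\<lambda>N. int (N + 1)) ` {N0..} \<subseteq> {x. poly (?\<chi> - Q) x = 0}"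
      using N0 by auto
    ultimately have "finite ((\<lambda>N. int (N + 1)) ` {N0..})" by (rule rev_finite_subset)
    then have "finite {N0..}" by (rule finite_imageD) (simp add: inj_on_def)
    then show False using infinite_Ici by blast
  qed
  then have "\<bar>coeff ?\<chi> j\<bar> = \<bar>coeff P j\<bar>"
    by (simp add: Q_def coeff_pcompose_linear abs_mult power_abs)
  also have "coeff P j = int (card {(w, i) \<in> decorated_dyck_paths m n. num_compartments m (drop i w) = j})"
    unfolding P_def by (rule decorated_coeff[symmetric])
  finally show ?thesis by simp
qed

end
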